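(* Let $k$ be an arbitrary field, let $\alpha$ be a $k$-algebra automorphism of $k[[X]]$ of infinite order, and let $\widehat{S}=k[[X]][\theta;\alpha]$. Then $\widehat{S}$ satisfies $(\diamond)$.
   Context: $k[[X]][\theta;\alpha]$ is the skew polynomial ring with $\theta r=\alpha(r)\theta$ for $r\in k[[X]]$. A Noetherian ring $A$ satisfies $(\diamond)$ if the injective hull of every simple right or left $A$-module is locally Artinian, meaning that each of its finitely generated submodules is Artinian. *)

theory Defs
  imports "HOL-Algebra.Module" "HOL-Computational_Algebra.Formal_Power_Series"
    "HOL-Computational_Algebra.Polynomial"
begin

section \<open>Modules over a not necessarily commutative ring\<close>

text \<open>The locale \<^locale>\<open>module\<close> assumes a commutative ring of scalars. We keep its record type
  (whose fields \<open>mult\<close> and \<open>one\<close> are irrelevant for modules) and its locale \<^locale>\<open>submodule\<close>,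
  which does not depend on commutativity.\<close>

locale left_module = R?: ring R + M?: abelian_group M for R (structure) and M (structure) +
  assumes lsmult_closed:
      "\<lbrakk>a \<in> carrier R; x \<in> carrier M\<rbrakk> \<Longrightarrow> a \<odot>\<^bsub>M\<^esub> x \<in> carrier M"
    and lsmult_l_distr:
      "\<lbrakk>a \<in> carrier R; b \<in> carrier R; x \<in> carrier M\<rbrakk> \<Longrightarrow>
      (a \<oplus> b) \<odot>\<^bsub>M\<^esub> x = a \<odot>\<^bsub>M\<^esub> x \<oplus>\<^bsub>M\<^esub> b \<odot>\<^bsub>M\<^esub> x"
    and lsmult_r_distr:
      "\<lbrakk>a \<in> carrier R; x \<in> carrier M; y \<in> carrier M\<rbrakk> \<Longrightarrow>
      a \<odot>\<^bsub>M\<^esub> (x \<oplus>\<^bsub>M\<^esub> y) = a \<odot>\<^bsub>M\<^esub> x \<oplus>\<^bsub>M\<^esub> a \<odot>\<^bsub>M\<^esub> y"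
    and lsmult_assoc:
      "\<lbrakk>a \<in> carrier R; b \<in> carrier R; x \<in> carrier M\<rbrakk> \<Longrightarrow>
      (a \<otimes> b) \<odot>\<^bsub>M\<^esub> x = a \<odot>\<^bsub>M\<^esub> (b \<odot>\<^bsub>M\<^esub> x)"
    and lsmult_one:
      "x \<in> carrier M \<Longrightarrow> \<one> \<odot>\<^bsub>M\<^esub> x = x"

text \<open>Right modules over \<open>R\<close> are left modules over the opposite ring.\<close>

definition opposite_ring :: "('a, 'm) ring_scheme \<Rightarrow> ('a, 'm) ring_scheme" where
  "opposite_ring R = R\<lparr>monoid.mult := (\<lambda>x y. y \<otimes>\<^bsub>R\<^esub> x)\<rparr>"

definition regular_module :: "('a, 'm) ring_scheme \<Rightarrow> ('a, 'a) module" where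
  "regular_module R = \<lparr>carrier = carrier R, monoid.mult = monoid.mult R, one = one R,
     zero = zero R, add = add R, module.smult = monoid.mult R\<rparr>"

definition lmodule_hom ::
    "('a, 'm) ring_scheme \<Rightarrow> ('a, 'b) module \<Rightarrow> ('a, 'c) module \<Rightarrow> ('b \<Rightarrow> 'c) set" where
  "lmodule_hom R M N = {f. f \<in> carrier M \<rightarrow> carrier N \<and>
     (\<forall>x \<in> carrier M. \<forall>y \<in> carrier M. f (x \<oplus>\<^bsub>M\<^esub> y) = f x \<oplus>\<^bsub>N\<^esub> f y) \<and>
     (\<forall>a \<in> carrier R. \<forall>x \<in> carrier M. f (a \<odot>\<^bsub>M\<^esub> x) = a \<odot>\<^bsub>N\<^esub> f x)}"

definition span_submodule :: "('a, 'm) ring_scheme \<Rightarrow> ('a, 'b) module \<Rightarrow> 'b set \<Rightarrow> 'b set" where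
  "span_submodule R M F = \<Inter>{H. submodule H R M \<and> F \<subseteq> H}"

definition fg_submodule :: "('a, 'm) ring_scheme \<Rightarrow> ('a, 'b) module \<Rightarrow> 'b set \<Rightarrow> bool" where
  "fg_submodule R M N \<longleftrightarrow>
     submodule N R M \<and> (\<exists>F. finite F \<and> F \<subseteq> carrier M \<and> N = span_submodule R M F)"

definition simple_module :: "('a, 'm) ring_scheme \<Rightarrow> ('a, 'b) module \<Rightarrow> bool" where
  "simple_module R M \<longleftrightarrow> left_module R M \<and> carrier M \<noteq> {\<zero>\<^bsub>M\<^esub>} \<and>
     (\<forall>H. submodule H R M \<longrightarrow> H = {\<zero>\<^bsub>M\<^esub>} \<or> H = carrier M)"

definition artinian_module :: "('a, 'm) ring_scheme \<Rightarrow> ('a, 'b) module \<Rightarrow> bool" where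
  "artinian_module R M \<longleftrightarrow> left_module R M \<and>
     (\<forall>H :: nat \<Rightarrow> 'b set. (\<forall>n. submodule (H n) R M) \<and> (\<forall>n. H (Suc n) \<subseteq> H n) \<longrightarrow>
        (\<exists>n. \<forall>m\<ge>n. H m = H n))"

definition noetherian_module :: "('a, 'm) ring_scheme \<Rightarrow> ('a, 'b) module \<Rightarrow> bool" where
  "noetherian_module R M \<longleftrightarrow> left_module R M \<and>
     (\<forall>H :: nat \<Rightarrow> 'b set. (\<forall>n. submodule (H n) R M) \<and> (\<forall>n. H n \<subseteq> H (Suc n)) \<longrightarrow>
        (\<exists>n. \<forall>m\<ge>n. H m = H n))"

definition locally_artinian :: "('a, 'm) ring_scheme \<Rightarrow> ('a, 'b) module \<Rightarrow> bool" where
  "locally_artinian R M \<longleftrightarrow> left_module R M \<and>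
     (\<forall>N. fg_submodule R M N \<longrightarrow> artinian_module R (M\<lparr>carrier := N\<rparr>))"

text \<open>The library's \<open>noetherian_ring\<close> concerns two-sided ideals only, hence the following.\<close>

definition two_sided_noetherian :: "('a, 'm) ring_scheme \<Rightarrow> bool" where
  "two_sided_noetherian R \<longleftrightarrow> ring R \<and> noetherian_module R (regular_module R) \<and>
     noetherian_module (opposite_ring R) (regular_module (opposite_ring R))"


section \<open>Injective hulls and the property (diamond)\<close>

text \<open>HOL cannot quantify over types inside a definition, so the test modules \<open>M\<close>, \<open>N\<close> for the
  injectivity of \<open>E\<close> range over all modules carried by sets of the element type of the ring. By
  Baer's criterion (take \<open>M\<close> a left ideal and \<open>N\<close> the ring) this is the usual injectivity; and as
  injectivity is only used as a hypothesis on \<open>E\<close>, the restriction cannot weaken (diamond).\<close>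

definition injective_module :: "('a, 'm) ring_scheme \<Rightarrow> ('a, 'e) module \<Rightarrow> bool" where
  "injective_module R E \<longleftrightarrow> left_module R E \<and>
     (\<forall>(M :: ('a, 'a) module) (N :: ('a, 'a) module) i f.
        left_module R M \<and> left_module R N \<and> i \<in> lmodule_hom R M N \<and> inj_on i (carrier M) \<and>
        f \<in> lmodule_hom R M E \<longrightarrow>
        (\<exists>g \<in> lmodule_hom R N E. \<forall>x \<in> carrier M. g (i x) = f x))"

definition essential_submodule ::
    "('a, 'm) ring_scheme \<Rightarrow> ('a, 'e) module \<Rightarrow> 'e set \<Rightarrow> bool" where
  "essential_submodule R E U \<longleftrightarrow> submodule U R E \<and>
     (\<forall>H. submodule H R E \<and> H \<inter> U = {\<zero>\<^bsub>E\<^esub>} \<longrightarrow> H = {\<zero>\<^bsub>E\<^esub>})"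

definition injective_hull ::
    "('a, 'm) ring_scheme \<Rightarrow> ('a, 's) module \<Rightarrow> ('a, 'e) module \<Rightarrow> ('s \<Rightarrow> 'e) \<Rightarrow> bool" where
  "injective_hull R S E \<iota> \<longleftrightarrow> left_module R S \<and> injective_module R E \<and>
     \<iota> \<in> lmodule_hom R S E \<and> inj_on \<iota> (carrier S) \<and> essential_submodule R E (\<iota> ` carrier S)"

text \<open>The types \<open>'s\<close> and \<open>'e\<close> carry the simple modules and their hulls. A theorem in which they are
  free type variables speaks about all simple modules and all of their hulls.\<close>

definition left_diamond ::
    "'s itself \<Rightarrow> 'e itself \<Rightarrow> ('a, 'm) ring_scheme \<Rightarrow> bool" where
  "left_diamond _ _ R \<longleftrightarrow>
     (\<forall>(S :: ('a, 's) module) (E :: ('a, 'e) module) \<iota>.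
        simple_module R S \<and> injective_hull R S E \<iota> \<longrightarrow> locally_artinian R E)"

definition satisfies_diamond ::
    "'s itself \<Rightarrow> 'e itself \<Rightarrow> ('a, 'm) ring_scheme \<Rightarrow> bool" where
  "satisfies_diamond s e A \<longleftrightarrow> two_sided_noetherian A \<and>
     left_diamond s e A \<and> left_diamond s e (opposite_ring A)"


section \<open>Skew polynomial rings and automorphisms of \<open>k[[X]]\<close>\<close>

text \<open>The polynomial with coefficients \<open>a\<^sub>i\<close> stands for \<open>\<Sum>\<^sub>i a\<^sub>i \<theta>\<^sup>i\<close>, with coefficients on the left;
  \<open>\<theta> r = \<alpha>(r) \<theta>\<close> forces \<open>(a \<theta>\<^sup>i) (b \<theta>\<^sup>j) = a \<alpha>\<^sup>i(b) \<theta>\<^sup>i\<^sup>+\<^sup>j\<close>.\<close>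

definition skew_poly_mult ::
    "('r::comm_ring_1 \<Rightarrow> 'r) \<Rightarrow> 'r poly \<Rightarrow> 'r poly \<Rightarrow> 'r poly" where
  "skew_poly_mult \<alpha> p q =
     (\<Sum>i\<le>degree p. \<Sum>j\<le>degree q. monom (coeff p i * (\<alpha> ^^ i) (coeff q j)) (i + j))"

definition skew_poly_ring :: "('r::comm_ring_1 \<Rightarrow> 'r) \<Rightarrow> 'r poly ring" where
  "skew_poly_ring \<alpha> =
     \<lparr>carrier = UNIV, monoid.mult = skew_poly_mult \<alpha>, one = 1, zero = 0, add = (+)\<rparr>"

definition fps_algebra_automorphism :: "('k::field fps \<Rightarrow> 'k fps) \<Rightarrow> bool" where
  "fps_algebra_automorphism \<alpha> \<longleftrightarrow> bij \<alpha> \<and> \<alpha> 1 = 1 \<and>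
     (\<forall>f g. \<alpha> (f + g) = \<alpha> f + \<alpha> g) \<and> (\<forall>f g. \<alpha> (f * g) = \<alpha> f * \<alpha> g) \<and>
     (\<forall>c f. \<alpha> (fps_const c * f) = fps_const c * \<alpha> f)"

definition infinite_order :: "('b \<Rightarrow> 'b) \<Rightarrow> bool" where
  "infinite_order \<alpha> \<longleftrightarrow> (\<forall>n>0. \<alpha> ^^ n \<noteq> id)"

end

theory Submission
  imports Defs "HOL-Algebra.AbelCoset"
begin

text \<open>Write \<open>S\<close> for the skew polynomial ring. An automorphism of \<open>k[[X]]\<close> preserves the maximal ideal, so
\<open>\<alpha>(X)\<close> is \<open>X\<close> times a unit and \<open>X\<close> is a normal element of \<open>S\<close>: \<open>XS = SX\<close>. For a left ideal \<open>J\<close> let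
\<open>leading_exponents J\<close> be the set of pairs \<open>(i, v)\<close> such that \<open>J\<close> contains an element of degree \<open>i\<close> with
leading coefficient \<open>X\<^sup>v\<close>. This is an up-closed subset of \<open>\<nat> \<times> \<nat>\<close>, and it separates nested left ideals
(\<open>left_ideal_eqI\<close>); Dickson's lemma then makes \<open>S\<close> left Noetherian.

Let \<open>V\<close> be a simple left module, \<open>E\<close> an essential extension of \<open>V\<close>, and \<open>m \<in> E\<close>. A finitely generated
submodule is a finite sum of cyclic ones, so it is enough that \<open>Sm\<close> is Artinian (\<open>cyclic_dcc\<close>). As
\<open>X\<close> is normal, \<open>XV\<close> is a submodule of \<open>V\<close>, hence \<open>XV = 0\<close> or \<open>XV = V\<close>.

If \<open>XV = 0\<close>, the Noetherian property shows that a power of \<open>X\<close> kills \<open>m\<close>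
(\<open>torsion_case_fps_X_nilpotent\<close>), and working modulo \<open>X\<close>, that is over \<open>k[\<theta>]\<close>, produces an annihilator
of \<open>m\<close> with a unit as leading coefficient (\<open>torsion_case_unit_lead_annihilator\<close>). Then \<open>Sm\<close> is a
finitely generated \<open>k[[X]]\<close>-module killed by a power of \<open>X\<close>; in terms of leading exponents, only
finitely many pairs are left to distinguish the submodules of \<open>Sm\<close>.

If \<open>XV = V\<close>, then \<open>X\<close> acts injectively on \<open>E\<close>, and \<open>m\<close> has an annihilator \<open>f \<noteq> 0\<close> which is not a
multiple of \<open>X\<close> and has least degree. As \<open>k[[X]]\<close> is complete, Hensel's lemma
(\<open>hensel_factorization\<close>) factors it as \<open>f = h u\<close>, where \<open>h\<close> has a unit as leading coefficient and
\<open>u\<close> is \<open>1\<close> modulo \<open>X\<close>. The module generated by \<open>y = u m\<close> is a quotient of \<open>S/Sh\<close> and, by the choice of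
\<open>f\<close>, is free of finite rank over \<open>k[[X]]\<close>; it cannot contain the \<open>X\<close>-divisible module \<open>V\<close>. As \<open>V\<close> lies in
every nonzero submodule of \<open>E\<close>, this forces \<open>u m = 0\<close>. So \<open>m \<in> SXm\<close> for every \<open>m \<in> E\<close>, which means
that all submodules of \<open>E\<close> are \<open>X\<close>-divisible. They behave like subspaces over the field of Laurent
series, and \<open>Sm\<close> has finite dimension because a nonzero polynomial kills \<open>m\<close>.

For right modules, the opposite ring of \<open>S\<close> is the skew polynomial ring of the inverse automorphism
(\<open>scalar_change_opposite_skew_poly_ring\<close>), to which everything above applies.\<close>

unbundle fps_syntax

section \<open>Arithmetic of skew polynomials\<close>

text \<open>Identities between skew polynomials that are additive in each argument need only be checked on
monomials.\<close>

lemma poly_additive_induct: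
  assumes "\<And>a i. P (monom a i)" and "\<And>p q. P p \<Longrightarrow> P q \<Longrightarrow> P (p + q)"
  shows "P (p :: 'a::comm_monoid_add poly)"
proof -
  have "P (\<Sum>i\<in>A. monom (coeff p i) i)" if "finite A" for A :: "nat set"
    using that
  proof induction
    case empty
    then show ?case using assms(1)[of 0 0] by simp
  next
    case (insert x F)
    then show ?case using assms by simp
  qed
  from this[of "{..degree p}"] show ?thesis by (simp add: poly_as_sum_of_monoms)
qed

locale skew_endo =
  fixes \<sigma> :: "'r::comm_ring_1 \<Rightarrow> 'r"
  assumes endo_add: "\<sigma> (a + b) = \<sigma> a + \<sigma> b"
    and endo_mult: "\<sigma> (a * b) = \<sigma> a * \<sigma> b"
    and endo_one: "\<sigma> 1 = 1"
begin

abbreviation skew_mult (infixl \<open>\<star>\<close> 70) where "p \<star> q \<equiv> skew_poly_mult \<sigma> p q"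

lemma pow_add: "(\<sigma> ^^ i) (a + b) = (\<sigma> ^^ i) a + (\<sigma> ^^ i) b"
  by (induction i) (auto simp: endo_add)

lemma pow_mult: "(\<sigma> ^^ i) (a * b) = (\<sigma> ^^ i) a * (\<sigma> ^^ i) b"
  by (induction i) (auto simp: endo_mult)

lemma pow_one [simp]: "(\<sigma> ^^ i) 1 = 1"
  by (induction i) (auto simp: endo_one)

lemma pow_zero [simp]: "(\<sigma> ^^ i) 0 = 0"
  using pow_add[of i 0 0] by simp

lemma pow_power: "(\<sigma> ^^ i) (a ^ n) = ((\<sigma> ^^ i) a) ^ n"
  by (induction n) (auto simp: pow_mult)

text \<open>The double sum defining the product ranges over the degrees of the factors; collecting terms of
equal degree gives a convolution formula that no longer mentions degrees.\<close>

lemma coeff_skew_mult: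
  "coeff (p \<star> q) n = (\<Sum>i\<le>n. coeff p i * (\<sigma> ^^ i) (coeff q (n - i)))"
proof -
  let ?c = "\<lambda>i j. coeff p i * (\<sigma> ^^ i) (coeff q j)"
  have inner: "(\<Sum>j\<le>degree q. coeff (monom (?c i j) (i + j)) n) = (if i \<le> n then ?c i (n - i) else 0)"
    for i
  proof -
    have "(\<Sum>j\<le>degree q. coeff (monom (?c i j) (i + j)) n) =
        (\<Sum>j\<le>degree q. if j = n - i then (if i \<le> n then ?c i (n - i) else 0) else 0)"
      by (intro sum.cong) auto
    also have "\<dots> = (if n - i \<le> degree q then (if i \<le> n then ?c i (n - i) else 0) else 0)"
      by (subst sum.delta) auto
    also have "\<dots> = (if i \<le> n then ?c i (n - i) else 0)"
      by (auto simp: coeff_eq_0)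
    finally show ?thesis .
  qed
  have "coeff (p \<star> q) n = (\<Sum>i\<le>degree p. if i \<le> n then ?c i (n - i) else 0)"
    unfolding skew_poly_mult_def coeff_sum inner ..
  also have "\<dots> = (\<Sum>i\<in>{..degree p} \<inter> {..n}. ?c i (n - i))"
    by (subst sum.inter_restrict) auto
  also have "\<dots> = (\<Sum>i\<le>n. ?c i (n - i))"
    by (rule sum.mono_neutral_left) (auto intro!: le_degree)
  finally show ?thesis .
qed

lemma skew_add_left: "(p + q) \<star> r = p \<star> r + q \<star> r"
  by (rule poly_eqI) (simp add: coeff_skew_mult algebra_simps sum.distrib)

lemma skew_add_right: "p \<star> (q + r) = p \<star> q + p \<star> r"
  by (rule poly_eqI) (simp add: coeff_skew_mult pow_add algebra_simps sum.distrib)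

lemma skew_zero_left [simp]: "0 \<star> p = 0"
  by (rule poly_eqI) (simp add: coeff_skew_mult)

lemma skew_zero_right [simp]: "p \<star> 0 = 0"
  by (rule poly_eqI) (simp add: coeff_skew_mult)

lemma skew_minus_left: "(- p) \<star> q = - (p \<star> q)"
  using skew_add_left[of p "- p" q] by (simp add: add_eq_0_iff)

lemma skew_minus_right: "p \<star> (- q) = - (p \<star> q)"
  using skew_add_right[of p q "- q"] by (simp add: add_eq_0_iff)

lemma skew_diff_left: "(p - q) \<star> r = p \<star> r - q \<star> r"
  using skew_add_left[of p "- q" r] by (simp add: skew_minus_left)

lemma skew_diff_right: "p \<star> (q - r) = p \<star> q - p \<star> r"
  using skew_add_right[of p q "- r"] by (simp add: skew_minus_right)

lemma coeff_monom_skew: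
  "coeff (monom a i \<star> q) n = (if i \<le> n then a * (\<sigma> ^^ i) (coeff q (n - i)) else 0)"
proof -
  have "coeff (monom a i \<star> q) n =
      (\<Sum>l\<le>n. if l = i then a * (\<sigma> ^^ i) (coeff q (n - i)) else 0)"
    unfolding coeff_skew_mult by (intro sum.cong) auto
  then show ?thesis by simp
qed

lemma const_skew: "[:a:] \<star> q = smult a q"
  using coeff_monom_skew[of a 0 q] by (intro poly_eqI) (simp add: monom_0)

lemma one_skew [simp]: "1 \<star> q = q"
  using const_skew[of 1 q] by (simp add: one_pCons)

lemma skew_one [simp]: "p \<star> 1 = p"
proof (rule poly_eqI)
  fix n
  have "coeff (p \<star> 1) n = (\<Sum>i\<le>n. if i = n then coeff p n else 0)"
    unfolding coeff_skew_mult by (intro sum.cong) auto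
  then show "coeff (p \<star> 1) n = coeff p n" by simp
qed

lemma monom_skew_monom: "monom a i \<star> monom b j = monom (a * (\<sigma> ^^ i) b) (i + j)"
  by (rule poly_eqI) (auto simp: coeff_monom_skew)

lemma skew_assoc: "(p \<star> q) \<star> r = p \<star> (q \<star> r)"
proof (induction p rule: poly_additive_induct)
  case (1 a i)
  show ?case
  proof (induction q rule: poly_additive_induct)
    case (1 b j)
    show ?case
    proof (induction r rule: poly_additive_induct)
      case (1 c l)
      then show ?case by (simp add: monom_skew_monom pow_mult funpow_add ac_simps)
    qed (simp add: skew_add_right)
  qed (simp add: skew_add_left skew_add_right)
qed (simp add: skew_add_left)

lemma ring_skew_poly_ring: "ring (skew_poly_ring \<sigma>)"
proof (rule ringI)
  show "abelian_group (skew_poly_ring \<sigma>)"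
    by (rule abelian_groupI) (auto simp: skew_poly_ring_def ac_simps intro: exI[of _ "- _"])
  show "monoid (skew_poly_ring \<sigma>)"
    by (rule monoidI) (auto simp: skew_poly_ring_def skew_assoc)
qed (auto simp: skew_poly_ring_def skew_add_left skew_add_right)

lemma degree_skew_le: "degree (p \<star> q) \<le> degree p + degree q"
proof (rule degree_le, intro allI impI)
  fix n assume "degree p + degree q < n"
  then have "coeff p i = 0 \<or> coeff q (n - i) = 0" for i
    by (cases "i \<le> degree p") (auto intro: coeff_eq_0)
  then have "coeff p i * (\<sigma> ^^ i) (coeff q (n - i)) = 0" for i
    using pow_zero by (metis mult_zero_left mult_zero_right)
  then show "coeff (p \<star> q) n = 0" by (simp add: coeff_skew_mult)
qed

lemma coeff_skew_top:
  assumes "\<And>i. i > m \<Longrightarrow> coeff p i = 0" "\<And>i. i > n \<Longrightarrow> coeff q i = 0"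
  shows "coeff (p \<star> q) (m + n) = coeff p m * (\<sigma> ^^ m) (coeff q n)"
proof -
  have "coeff p i * (\<sigma> ^^ i) (coeff q (m + n - i)) =
      (if i = m then coeff p m * (\<sigma> ^^ m) (coeff q n) else 0)" for i
    using assms by (cases i m rule: linorder_cases) auto
  then show ?thesis by (simp add: coeff_skew_mult)
qed

end

section \<open>The opposite of a skew polynomial ring\<close>

text \<open>In the opposite ring the product of \<open>\<theta>\<close> and \<open>a\<close>, in this order, is \<open>a \<theta> = \<theta> \<sigma>\<^sup>-\<^sup>1(a)\<close>, which is the
product of \<open>\<sigma>\<^sup>-\<^sup>1(a)\<close> and \<open>\<theta>\<close> there. So the opposite ring is a skew polynomial ring for \<open>\<sigma>\<^sup>-\<^sup>1\<close>. What it
writes as \<open>\<Sum>\<^sub>i a\<^sub>i \<theta>\<^sup>i\<close> is \<open>\<Sum>\<^sub>i \<theta>\<^sup>i a\<^sub>i = \<Sum>\<^sub>i \<sigma>\<^sup>i(a\<^sub>i) \<theta>\<^sup>i\<close> in the original ring.\<close>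

definition twist_coeffs :: "('r \<Rightarrow> 'r) \<Rightarrow> 'r::comm_ring_1 poly \<Rightarrow> 'r poly" where
  "twist_coeffs \<sigma> p = (\<Sum>i\<le>degree p. monom ((\<sigma> ^^ i) (coeff p i)) i)"

context skew_endo
begin

lemma coeff_twist_coeffs: "coeff (twist_coeffs \<sigma> p) n = (\<sigma> ^^ n) (coeff p n)"
proof -
  have "coeff (twist_coeffs \<sigma> p) n =
      (\<Sum>i\<le>degree p. if i = n then (\<sigma> ^^ n) (coeff p n) else 0)"
    unfolding twist_coeffs_def coeff_sum by (intro sum.cong) auto
  then show ?thesis by (auto simp: coeff_eq_0)
qed

lemma twist_coeffs_add: "twist_coeffs \<sigma> (p + q) = twist_coeffs \<sigma> p + twist_coeffs \<sigma> q"
  by (rule poly_eqI) (simp add: coeff_twist_coeffs pow_add)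

lemma twist_coeffs_monom: "twist_coeffs \<sigma> (monom a i) = monom ((\<sigma> ^^ i) a) i"
  by (rule poly_eqI) (simp add: coeff_twist_coeffs)

lemma twist_coeffs_one: "twist_coeffs \<sigma> 1 = 1"
  using twist_coeffs_monom[of 1 0] by (simp add: monom_0 one_pCons)

lemma twist_coeffs_skew_mult:
  assumes "skew_endo \<tau>" and inv: "\<And>a. \<sigma> (\<tau> a) = a"
  shows "twist_coeffs \<sigma> (skew_poly_mult \<tau> p q) = twist_coeffs \<sigma> q \<star> twist_coeffs \<sigma> p"
proof -
  interpret \<tau>: skew_endo \<tau> by fact
  have cancel: "(\<sigma> ^^ (i + j)) ((\<tau> ^^ i) b) = (\<sigma> ^^ j) b" for i j b
  proof (induction i arbitrary: j b)
    case (Suc i)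
    have "(\<sigma> ^^ (Suc i + j)) ((\<tau> ^^ Suc i) b) = (\<sigma> ^^ (i + j)) (\<sigma> (\<tau> ((\<tau> ^^ i) b)))"
      by (simp add: funpow_swap1)
    then show ?case using Suc by (simp add: inv)
  qed simp
  show ?thesis
  proof (induction p rule: poly_additive_induct)
    case (1 a i)
    show ?case
    proof (induction q rule: poly_additive_induct)
      case (1 b j)
      have "(\<sigma> ^^ (i + j)) (a * (\<tau> ^^ i) b) = (\<sigma> ^^ j) b * (\<sigma> ^^ j) ((\<sigma> ^^ i) a)"
        by (simp only: pow_mult cancel)
           (simp add: add.commute[of i j] funpow_add mult.commute)
      then show ?case
        by (simp add: \<tau>.monom_skew_monom monom_skew_monom twist_coeffs_monom add.commute)
    qed (simp add: \<tau>.skew_add_right skew_add_left twist_coeffs_add)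
  qed (simp add: \<tau>.skew_add_left skew_add_right twist_coeffs_add)
qed

lemma surj_twist_coeffs:
  assumes "skew_endo \<tau>" and inv: "\<And>a. \<sigma> (\<tau> a) = a"
  shows "surj (twist_coeffs \<sigma>)"
proof -
  interpret \<tau>: skew_endo \<tau> by fact
  have "(\<sigma> ^^ n) ((\<tau> ^^ n) a) = a" for n a
  proof (induction n arbitrary: a)
    case (Suc n)
    have "(\<sigma> ^^ Suc n) ((\<tau> ^^ Suc n) a) = (\<sigma> ^^ n) (\<sigma> (\<tau> ((\<tau> ^^ n) a)))"
      by (simp add: funpow_swap1)
    then show ?case using Suc by (simp add: inv)
  qed simp
  then have "twist_coeffs \<sigma> (twist_coeffs \<tau> p) = p" for p
    by (intro poly_eqI) (simp add: coeff_twist_coeffs \<tau>.coeff_twist_coeffs)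
  then show ?thesis by (metis surjI)
qed

end

section \<open>Chain conditions and changes of scalars for left modules\<close>

text \<open>The notions of the chain conditions are stated for module records without extension fields, hence
the restriction of the type of \<open>M\<close>.\<close>

locale plain_left_module = left_module R M
  for R :: "('a, 'm) ring_scheme" (structure) and M :: "('a, 'b) module" (structure)
begin

lemma lsmult_zero_left: "x \<in> carrier M \<Longrightarrow> \<zero> \<odot>\<^bsub>M\<^esub> x = \<zero>\<^bsub>M\<^esub>"
  using lsmult_l_distr[of \<zero> \<zero> x] lsmult_closed[of \<zero> x] M.add.r_cancel_one' by fastforce

lemma lsmult_zero_right: "a \<in> carrier R \<Longrightarrow> a \<odot>\<^bsub>M\<^esub> \<zero>\<^bsub>M\<^esub> = \<zero>\<^bsub>M\<^esub>"
  using lsmult_r_distr[of a "\<zero>\<^bsub>M\<^esub>" "\<zero>\<^bsub>M\<^esub>"] lsmult_closed[of a "\<zero>\<^bsub>M\<^esub>"] M.add.r_cancel_one'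
  by fastforce

lemma lsmult_minus_left:
  assumes "a \<in> carrier R" "x \<in> carrier M"
  shows "(\<ominus> a) \<odot>\<^bsub>M\<^esub> x = \<ominus>\<^bsub>M\<^esub> (a \<odot>\<^bsub>M\<^esub> x)"
proof -
  have "(\<ominus> a) \<odot>\<^bsub>M\<^esub> x \<oplus>\<^bsub>M\<^esub> a \<odot>\<^bsub>M\<^esub> x = \<zero>\<^bsub>M\<^esub>"
    using lsmult_l_distr[of "\<ominus> a" a x] assms by (simp add: R.l_neg lsmult_zero_left)
  then show ?thesis using assms by (metis M.minus_equality R.a_inv_closed lsmult_closed)
qed

lemma submoduleI:
  assumes "H \<subseteq> carrier M" "\<zero>\<^bsub>M\<^esub> \<in> H"
    and "\<And>x y. x \<in> H \<Longrightarrow> y \<in> H \<Longrightarrow> x \<oplus>\<^bsub>M\<^esub> y \<in> H"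
    and smult: "\<And>a x. a \<in> carrier R \<Longrightarrow> x \<in> H \<Longrightarrow> a \<odot>\<^bsub>M\<^esub> x \<in> H"
  shows "submodule H R M"
proof -
  have "\<ominus>\<^bsub>M\<^esub> x \<in> H" if "x \<in> H" for x
    using smult[of "\<ominus> \<one>" x] lsmult_minus_left[of \<one> x] lsmult_one[of x] that assms(1) by auto
  then show ?thesis
    using assms by (auto intro!: submodule.intro subgroup.intro simp: submodule_axioms_def a_inv_def)
qed

lemma submoduleD:
  assumes "submodule H R M"
  shows "H \<subseteq> carrier M" "\<zero>\<^bsub>M\<^esub> \<in> H"
    and "\<And>x y. x \<in> H \<Longrightarrow> y \<in> H \<Longrightarrow> x \<oplus>\<^bsub>M\<^esub> y \<in> H"
    and "\<And>a x. a \<in> carrier R \<Longrightarrow> x \<in> H \<Longrightarrow> a \<odot>\<^bsub>M\<^esub> x \<in> H"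
    and "\<And>x. x \<in> H \<Longrightarrow> \<ominus>\<^bsub>M\<^esub> x \<in> H"
    and "\<And>x y. x \<in> H \<Longrightarrow> y \<in> H \<Longrightarrow> x \<ominus>\<^bsub>M\<^esub> y \<in> H"
proof -
  interpret H: submodule H R M by fact
  show "H \<subseteq> carrier M" "\<zero>\<^bsub>M\<^esub> \<in> H"
    and "\<And>x y. x \<in> H \<Longrightarrow> y \<in> H \<Longrightarrow> x \<oplus>\<^bsub>M\<^esub> y \<in> H"
    and "\<And>a x. a \<in> carrier R \<Longrightarrow> x \<in> H \<Longrightarrow> a \<odot>\<^bsub>M\<^esub> x \<in> H"
    and "\<And>x. x \<in> H \<Longrightarrow> \<ominus>\<^bsub>M\<^esub> x \<in> H"
    using H.subset H.one_closed H.m_closed H.smult_closed H.m_inv_closed by (auto simp: a_inv_def)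
  then show "\<And>x y. x \<in> H \<Longrightarrow> y \<in> H \<Longrightarrow> x \<ominus>\<^bsub>M\<^esub> y \<in> H"
    by (simp add: a_minus_def)
qed

lemma submodule_left_module:
  assumes "submodule H R M"
  shows "left_module R (M\<lparr>carrier := H\<rparr>)"
proof -
  note H = submoduleD[OF assms]
  have sub: "x \<in> carrier M" if "x \<in> H" for x using H(1) that by auto
  have "abelian_group (M\<lparr>carrier := H\<rparr>)"
  proof (rule abelian_groupI)
    fix x assume "x \<in> carrier (M\<lparr>carrier := H\<rparr>)"
    then show "\<exists>y\<in>carrier (M\<lparr>carrier := H\<rparr>). y \<oplus>\<^bsub>M\<lparr>carrier := H\<rparr>\<^esub> x = \<zero>\<^bsub>M\<lparr>carrier := H\<rparr>\<^esub>"
      using H(5)[of x] sub M.l_neg[of x] by auto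
  qed (use H sub in \<open>auto simp: M.a_assoc intro: M.a_comm\<close>)
  then show ?thesis
    using H sub R.ring_axioms
    by (auto intro!: left_module.intro left_module_axioms.intro
        simp: lsmult_l_distr lsmult_r_distr lsmult_assoc lsmult_one)
qed

lemma submodule_restrict_carrier:
  assumes "submodule N R M" "submodule H R (M\<lparr>carrier := N\<rparr>)"
  shows "submodule H R M" "H \<subseteq> N"
proof -
  interpret N: plain_left_module R "M\<lparr>carrier := N\<rparr>"
    by (intro plain_left_module.intro submodule_left_module assms(1))
  note H = N.submoduleD[OF assms(2)]
  show "H \<subseteq> N" using H(1) by simp
  then show "submodule H R M"
    using H submoduleD(1)[OF assms(1)] by (intro submoduleI) auto
qed

definition cyclic :: "'b \<Rightarrow> 'b set" where
  "cyclic m = {a \<odot>\<^bsub>M\<^esub> m |a. a \<in> carrier R}"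

lemma cyclic_submodule:
  assumes "m \<in> carrier M"
  shows "submodule (cyclic m) R M"
proof (rule submoduleI)
  show "\<zero>\<^bsub>M\<^esub> \<in> cyclic m"
    unfolding cyclic_def using lsmult_zero_left[OF assms] by force
  show "x \<oplus>\<^bsub>M\<^esub> y \<in> cyclic m" if "x \<in> cyclic m" "y \<in> cyclic m" for x y
    using that lsmult_l_distr[OF _ _ assms, symmetric] unfolding cyclic_def by auto
  show "a \<odot>\<^bsub>M\<^esub> x \<in> cyclic m" if "a \<in> carrier R" "x \<in> cyclic m" for a x
    using that lsmult_assoc[OF _ _ assms, symmetric] unfolding cyclic_def by auto
qed (use assms lsmult_closed in \<open>auto simp: cyclic_def\<close>)

lemma mem_cyclic: "m \<in> carrier M \<Longrightarrow> m \<in> cyclic m"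
  unfolding cyclic_def using lsmult_one[of m] by force

lemma submodule_Int:
  "submodule H R M \<Longrightarrow> submodule K R M \<Longrightarrow> submodule (H \<inter> K) R M"
  using submoduleD[of H] submoduleD[of K] by (intro submoduleI) auto

lemma mem_sum_iff: "z \<in> H <+>\<^bsub>M\<^esub> K \<longleftrightarrow> (\<exists>x\<in>H. \<exists>y\<in>K. z = x \<oplus>\<^bsub>M\<^esub> y)"
  by (auto simp: set_add_def set_mult_def)

lemma submodule_sum:
  assumes "submodule H R M" "submodule K R M"
  shows "submodule (H <+>\<^bsub>M\<^esub> K) R M"
proof -
  note H = submoduleD[OF assms(1)] and K = submoduleD[OF assms(2)]
  note mem = mem_sum_iff[of _ H K]
  show ?thesis
  proof (rule submoduleI)
    show "H <+>\<^bsub>M\<^esub> K \<subseteq> carrier M"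
      using subsetD[OF H(1)] subsetD[OF K(1)] by (auto simp: mem)
    show "\<zero>\<^bsub>M\<^esub> \<in> H <+>\<^bsub>M\<^esub> K"
      unfolding mem by (intro bexI[of _ "\<zero>\<^bsub>M\<^esub>"]) (simp_all add: H(2) K(2))
    show "x \<oplus>\<^bsub>M\<^esub> y \<in> H <+>\<^bsub>M\<^esub> K" if "x \<in> H <+>\<^bsub>M\<^esub> K" "y \<in> H <+>\<^bsub>M\<^esub> K" for x y
    proof -
      from that mem obtain a b c d where *: "a \<in> H" "b \<in> K" "c \<in> H" "d \<in> K"
        "x = a \<oplus>\<^bsub>M\<^esub> b" "y = c \<oplus>\<^bsub>M\<^esub> d" by metis
      then have "x \<oplus>\<^bsub>M\<^esub> y = (a \<oplus>\<^bsub>M\<^esub> c) \<oplus>\<^bsub>M\<^esub> (b \<oplus>\<^bsub>M\<^esub> d)"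
        using H(1) K(1) by (simp add: M.a_ac subset_iff)
      then show ?thesis using * H(3) K(3) mem by blast
    qed
    show "a \<odot>\<^bsub>M\<^esub> x \<in> H <+>\<^bsub>M\<^esub> K" if a: "a \<in> carrier R" and "x \<in> H <+>\<^bsub>M\<^esub> K" for a x
    proof -
      from that mem obtain b c where *: "b \<in> H" "c \<in> K" "x = b \<oplus>\<^bsub>M\<^esub> c" by metis
      then have "a \<odot>\<^bsub>M\<^esub> x = a \<odot>\<^bsub>M\<^esub> b \<oplus>\<^bsub>M\<^esub> a \<odot>\<^bsub>M\<^esub> c"
        using H(1) K(1) a by (simp add: lsmult_r_distr subset_iff)
      then show ?thesis using * H(4) K(4) a mem by blast
    qed
  qed
qed

text \<open>Unlike \<open>artinian_module\<close> for the record restricted to \<open>N\<close>, this speaks about submodules of one fixed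
module, which is convenient for sums of submodules.\<close>

definition dcc_below :: "'b set \<Rightarrow> bool" where
  "dcc_below N \<longleftrightarrow> (\<forall>H :: nat \<Rightarrow> 'b set. (\<forall>n. submodule (H n) R M \<and> H n \<subseteq> N) \<longrightarrow>
     (\<forall>n. H (Suc n) \<subseteq> H n) \<longrightarrow> (\<exists>n. \<forall>m\<ge>n. H m = H n))"

lemma dcc_belowD:
  assumes "dcc_below N" "\<And>n. submodule (H n) R M" "\<And>n. H n \<subseteq> N" "\<And>n. H (Suc n) \<subseteq> H n"
  obtains n where "\<And>m. m \<ge> n \<Longrightarrow> H m = H (n :: nat)"
  using assms unfolding dcc_below_def by blast

text \<open>A submodule \<open>H\<close> of \<open>N + K\<close> is controlled by \<open>H \<inter> N\<close> and \<open>(H + N) \<inter> K\<close>: by the modular law, nested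
submodules for which both agree are equal. Both are chains in modules with the descending chain
condition.\<close>

lemma dcc_below_sum:
  assumes N: "submodule N R M" "dcc_below N" and K: "submodule K R M" "dcc_below K"
  shows "dcc_below (N <+>\<^bsub>M\<^esub> K)"
  unfolding dcc_below_def
proof (intro allI impI)
  fix H :: "nat \<Rightarrow> 'b set"
  assume H: "\<forall>n. submodule (H n) R M \<and> H n \<subseteq> N <+>\<^bsub>M\<^esub> K" and dec: "\<forall>n. H (Suc n) \<subseteq> H n"
  note mem = mem_sum_iff
  obtain n1 where n1: "\<And>m. m \<ge> n1 \<Longrightarrow> H m \<inter> N = H n1 \<inter> N"
    using dcc_belowD[OF N(2), of "\<lambda>n. H n \<inter> N"] H N(1) dec submodule_Int by blast
  let ?L = "\<lambda>n. (H n <+>\<^bsub>M\<^esub> N) \<inter> K"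
  have L: "submodule (?L n) R M" for n
    using H N(1) K(1) by (intro submodule_Int submodule_sum) auto
  have Ldec: "?L (Suc n) \<subseteq> ?L n" for n
    using dec by (fastforce simp: mem)
  obtain n2 where n2: "\<And>m. m \<ge> n2 \<Longrightarrow> ?L m = ?L n2"
    by (rule dcc_belowD[OF K(2), of ?L]) (use L Ldec in auto)
  have anti: "H m \<subseteq> H n" if "n \<le> m" for n m
    using that dec by (induction rule: dec_induct) auto
  show "\<exists>n. \<forall>m\<ge>n. H m = H n"
  proof (intro exI allI impI)
    fix m assume m: "m \<ge> max n1 n2"
    let ?n = "max n1 n2"
    have eqN: "H m \<inter> N = H ?n \<inter> N" using n1[of m] n1[of ?n] m by simp
    have eqL: "?L m = ?L ?n" using n2[of m] n2[of ?n] m by simp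
    note Hm = submoduleD[of "H m"] and Hn = submoduleD[of "H ?n"]
      and Ns = submoduleD[OF N(1)] and Ks = submoduleD[OF K(1)]
    have "H ?n \<subseteq> H m"
    proof
      fix x assume x: "x \<in> H ?n"
      obtain a b where ab: "a \<in> N" "b \<in> K" "x = a \<oplus>\<^bsub>M\<^esub> b"
        using H x mem by blast
      have c: "x \<in> carrier M" "a \<in> carrier M" "b \<in> carrier M"
        using ab Ns(1) Ks(1) by auto
      have "b = x \<oplus>\<^bsub>M\<^esub> \<ominus>\<^bsub>M\<^esub> a"
        using c ab(3) by (simp add: M.a_comm M.a_assoc M.r_neg1 M.r_neg2)
      then have "b \<in> ?L ?n" using x Ns(5)[OF ab(1)] ab(2) mem by blast
      then obtain h a' where h: "h \<in> H m" "a' \<in> N" "b = h \<oplus>\<^bsub>M\<^esub> a'"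
        using eqL mem by blast
      have hc: "h \<in> carrier M" "a' \<in> carrier M" using h Hm(1) H Ns(1) by auto
      have d: "x \<ominus>\<^bsub>M\<^esub> h = a \<oplus>\<^bsub>M\<^esub> a'"
        unfolding ab(3) h(3) a_minus_def using c hc by (simp add: M.a_ac M.r_neg1 M.r_neg2 M.r_neg)
      have "x \<ominus>\<^bsub>M\<^esub> h \<in> H ?n \<inter> N"
        using Hn(6)[of x h] x h(1) anti[OF m] H Ns(3) ab(1) h(2) d by auto
      then have "x \<ominus>\<^bsub>M\<^esub> h \<in> H m" using eqN by blast
      then have "(x \<ominus>\<^bsub>M\<^esub> h) \<oplus>\<^bsub>M\<^esub> h \<in> H m" using Hm(3) H h(1) by blast
      moreover have "(x \<ominus>\<^bsub>M\<^esub> h) \<oplus>\<^bsub>M\<^esub> h = x"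
        using c hc by (simp add: a_minus_def M.a_assoc M.l_neg)
      ultimately show "x \<in> H m" by simp
    qed
    then show "H m = H ?n" using anti[OF m] by blast
  qed
qed

lemma span_finite_dcc:
  assumes "finite F" "F \<subseteq> carrier M" and cyc: "\<And>m. m \<in> carrier M \<Longrightarrow> dcc_below (cyclic m)"
  shows "dcc_below (span_submodule R M F)"
proof -
  have "\<exists>N. submodule N R M \<and> F \<subseteq> N \<and> dcc_below N"
    using assms(1,2)
  proof induction
    case empty
    have "submodule {\<zero>\<^bsub>M\<^esub>} R M"
      by (rule submoduleI) (auto simp: lsmult_zero_right)
    moreover have "dcc_below {\<zero>\<^bsub>M\<^esub>}"
      unfolding dcc_below_def using submoduleD(2) by (metis subset_singletonD empty_iff)
    ultimately show ?case by blast
  next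
    case (insert x F)
    then obtain N where N: "submodule N R M" "F \<subseteq> N" "dcc_below N" by auto
    have x: "x \<in> carrier M" using insert by auto
    have "N \<subseteq> N <+>\<^bsub>M\<^esub> cyclic x" "x \<in> N <+>\<^bsub>M\<^esub> cyclic x"
    proof -
      show "N \<subseteq> N <+>\<^bsub>M\<^esub> cyclic x"
      proof
        fix y assume y: "y \<in> N"
        then have "y = y \<oplus>\<^bsub>M\<^esub> \<zero>\<^bsub>M\<^esub>" using submoduleD(1)[OF N(1)] by auto
        then show "y \<in> N <+>\<^bsub>M\<^esub> cyclic x"
          unfolding mem_sum_iff using y submoduleD(2)[OF cyclic_submodule[OF x]] by metis
      qed
      show "x \<in> N <+>\<^bsub>M\<^esub> cyclic x"
        unfolding mem_sum_iff using submoduleD(2)[OF N(1)] mem_cyclic[OF x] M.l_zero[OF x] by metis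
    qed
    then show ?case
      using submodule_sum[OF N(1) cyclic_submodule[OF x]]
        dcc_below_sum[OF N(1,3) cyclic_submodule[OF x] cyc[OF x]] N(2) by blast
  qed
  then obtain N where N: "submodule N R M" "F \<subseteq> N" "dcc_below N" by blast
  then have "span_submodule R M F \<subseteq> N" by (auto simp: span_submodule_def)
  then show ?thesis using N(3) unfolding dcc_below_def by (metis subset_trans)
qed

lemma locally_artinianI:
  assumes "\<And>m. m \<in> carrier M \<Longrightarrow> dcc_below (cyclic m)"
  shows "locally_artinian R M"
  unfolding locally_artinian_def
proof (intro conjI allI impI)
  show "left_module R M" by (rule left_module_axioms)
  fix N assume "fg_submodule R M N"
  then obtain F where F: "submodule N R M" "finite F" "F \<subseteq> carrier M" "N = span_submodule R M F"
    by (auto simp: fg_submodule_def)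
  then have "dcc_below N" using span_finite_dcc assms by blast
  then show "artinian_module R (M\<lparr>carrier := N\<rparr>)"
    unfolding artinian_module_def dcc_below_def
    using submodule_left_module[OF F(1)] submodule_restrict_carrier[OF F(1)] by blast
qed

end

text \<open>Along a surjective ring homomorphism, restriction of scalars keeps the underlying group and the
submodules, and so all notions that are defined through submodules.\<close>

definition restrict_scalars :: "('c \<Rightarrow> 'a) \<Rightarrow> ('a, 'b) module \<Rightarrow> ('c, 'b) module" where
  "restrict_scalars \<phi> M = \<lparr>carrier = carrier M, monoid.mult = monoid.mult M, one = one M,
     zero = zero M, add = add M, module.smult = (\<lambda>a. module.smult M (\<phi> a))\<rparr>"

lemma restrict_scalars_simps [simp]:
  "carrier (restrict_scalars \<phi> M) = carrier M"
  "add (restrict_scalars \<phi> M) = add M"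
  "zero (restrict_scalars \<phi> M) = zero M"
  "module.smult (restrict_scalars \<phi> M) a x = module.smult M (\<phi> a) x"
  "restrict_scalars \<phi> (M\<lparr>carrier := N\<rparr>) = (restrict_scalars \<phi> M)\<lparr>carrier := N\<rparr>"
  by (simp_all add: restrict_scalars_def)

locale scalar_change = R': ring R' + R: ring R for R' (structure) and R (structure) +
  fixes \<phi>
  assumes hom: "\<phi> \<in> ring_hom R' R" and onto: "\<phi> ` carrier R' = carrier R"
begin

lemma left_module_restrict:
  assumes "left_module R M"
  shows "left_module R' (restrict_scalars \<phi> M)"
proof -
  interpret M: plain_left_module R M by (intro plain_left_module.intro assms(1))
  have "abelian_group (restrict_scalars \<phi> M)"
    by (rule abelian_groupI) (auto simp: M.M.a_ac intro: M.M.l_neg)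
  then show ?thesis
    using ring_hom_memE[OF hom] R'.ring_axioms
    by (auto intro!: left_module.intro left_module_axioms.intro M.lsmult_closed
        simp: M.lsmult_l_distr M.lsmult_r_distr M.lsmult_assoc M.lsmult_one)
qed

lemma submodule_restrict_iff: "submodule H R' (restrict_scalars \<phi> M) \<longleftrightarrow> submodule H R M"
proof -
  have "(\<forall>a x. a \<in> carrier R' \<longrightarrow> x \<in> H \<longrightarrow> \<phi> a \<odot>\<^bsub>M\<^esub> x \<in> H) \<longleftrightarrow>
      (\<forall>a x. a \<in> carrier R \<longrightarrow> x \<in> H \<longrightarrow> a \<odot>\<^bsub>M\<^esub> x \<in> H)"
    unfolding onto[symmetric] image_iff by (metis (no_types))
  moreover have "subgroup H (add_monoid (restrict_scalars \<phi> M)) \<longleftrightarrow> subgroup H (add_monoid M)"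
    by (simp add: subgroup_def m_inv_def)
  ultimately show ?thesis
    unfolding submodule_def submodule_axioms_def by simp
qed

lemma simple_restrict: "simple_module R M \<Longrightarrow> simple_module R' (restrict_scalars \<phi> M)"
  unfolding simple_module_def by (simp add: submodule_restrict_iff left_module_restrict)

lemma lmodule_hom_restrict:
  assumes "f \<in> lmodule_hom R M N"
  shows "f \<in> lmodule_hom R' (restrict_scalars \<phi> M) (restrict_scalars \<phi> N)"
  using assms ring_hom_closed[OF hom] unfolding lmodule_hom_def by auto

lemma essential_restrict:
  "essential_submodule R E U \<Longrightarrow> essential_submodule R' (restrict_scalars \<phi> E) U"
  by (simp add: essential_submodule_def submodule_restrict_iff)

lemma locally_artinian_restrict:
  assumes "left_module R M" "locally_artinian R' (restrict_scalars \<phi> M)"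
  shows "locally_artinian R M"
proof -
  interpret M: plain_left_module R M by (intro plain_left_module.intro assms(1))
  have fg: "fg_submodule R' (restrict_scalars \<phi> M) N \<longleftrightarrow> fg_submodule R M N" for N
    by (simp add: fg_submodule_def span_submodule_def submodule_restrict_iff)
  have sub: "submodule H R' ((restrict_scalars \<phi> M)\<lparr>carrier := N\<rparr>) \<longleftrightarrow>
      submodule H R (M\<lparr>carrier := N\<rparr>)" for H N
    using submodule_restrict_iff[of H "M\<lparr>carrier := N\<rparr>"] by simp
  show ?thesis
    unfolding locally_artinian_def
  proof (intro conjI allI impI)
    fix N assume N: "fg_submodule R M N"
    then have "artinian_module R' ((restrict_scalars \<phi> M)\<lparr>carrier := N\<rparr>)"
      using assms(2) fg by (simp add: locally_artinian_def)
    then show "artinian_module R (M\<lparr>carrier := N\<rparr>)"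
      using N M.submodule_left_module by (simp add: artinian_module_def sub fg_submodule_def)
  qed fact
qed

lemma noetherian_restrict:
  assumes "left_module R M" "noetherian_module R' (restrict_scalars \<phi> M)"
  shows "noetherian_module R M"
  using assms by (simp add: noetherian_module_def submodule_restrict_iff)

end

section \<open>Skew polynomials over a power series ring\<close>

lemma fps_X_power_dvd_iff: "fps_X ^ n dvd (f :: 'k::field fps) \<longleftrightarrow> (\<forall>j<n. f $ j = 0)"
proof
  assume "fps_X ^ n dvd f"
  then show "\<forall>j<n. f $ j = 0" by (auto elim!: dvdE simp: fps_X_power_mult_nth)
next
  assume "\<forall>j<n. f $ j = 0"
  then have "f = fps_X ^ n * fps_shift n f"
    by (intro fps_ext) (auto simp: fps_X_power_mult_nth)
  then show "fps_X ^ n dvd f" by (metis dvdI)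
qed

lemma fps_X_dvd_iff: "fps_X dvd (f :: 'k::field fps) \<longleftrightarrow> f $ 0 = 0"
  using fps_X_power_dvd_iff[of 1 f] by simp

lemma fps_X_power_unit_decomp:
  assumes "(f :: 'k::field fps) \<noteq> 0"
  obtains v w w' where "f = fps_X ^ v * w" "w' * w = 1"
proof
  show "f = fps_X ^ subdegree f * unit_factor f"
    using fps_unit_factor_decompose[of f] by (simp add: fps_mult_fps_X_power_commute)
  show "inverse (unit_factor f) * unit_factor f = 1"
    using assms by (intro inverse_mult_eq_1) (simp add: nth_subdegree_nonzero)
qed

text \<open>Membership in the ideal \<open>X\<^sup>nS\<close>. It is two-sided, since automorphisms of \<open>k[[X]]\<close> preserve divisibility
by \<open>X\<^sup>n\<close>.\<close>

definition xdvd :: "nat \<Rightarrow> 'k::field fps poly \<Rightarrow> bool" where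
  "xdvd n p \<longleftrightarrow> (\<forall>i. fps_X ^ n dvd coeff p i)"

lemma xdvd_zero [simp]: "xdvd 0 p" "xdvd n 0"
  by (auto simp: xdvd_def)

lemma xdvd_add: "xdvd n p \<Longrightarrow> xdvd n q \<Longrightarrow> xdvd n (p + q)"
  by (auto simp: xdvd_def)

lemma xdvd_minus: "xdvd n p \<Longrightarrow> xdvd n (- p)"
  by (auto simp: xdvd_def)

lemma xdvd_diff: "xdvd n p \<Longrightarrow> xdvd n q \<Longrightarrow> xdvd n (p - q)"
  by (auto simp: xdvd_def)

lemma xdvd_mono: "xdvd n p \<Longrightarrow> m \<le> n \<Longrightarrow> xdvd m p"
  unfolding xdvd_def by (meson dvd_trans le_imp_power_dvd)

lemma xdvd_smult: "xdvd n (smult (fps_X ^ n) p)"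
  by (simp add: xdvd_def)

lemma xdvdE:
  assumes "xdvd n p"
  obtains q where "p = smult (fps_X ^ n) q"
proof -
  have "[:fps_X ^ n:] dvd p" using assms by (simp add: const_poly_dvd_iff xdvd_def)
  then show thesis using that by (auto elim!: dvdE)
qed

lemma xdvd_all_imp_zero:
  assumes "\<And>n. xdvd n p"
  shows "p = 0"
proof (intro poly_eqI fps_ext)
  fix i j
  show "coeff p i $ j = coeff 0 i $ j"
    using assms[of "Suc j"] by (simp add: xdvd_def fps_X_power_dvd_iff del: power_Suc)
qed

text \<open>The power of \<open>X\<close> that can be divided out is bounded, because no nonzero polynomial is divisible by
all of them.\<close>

lemma nonzero_primitive_part:
  assumes "p \<noteq> (0 :: 'k::field fps poly)"
  obtains n q where "p = smult (fps_X ^ n) q" "\<not> xdvd 1 q"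
proof -
  from assms obtain m where m: "\<not> xdvd m p" using xdvd_all_imp_zero by blast
  define n where "n = (LEAST m. \<not> xdvd m p)"
  have n: "\<not> xdvd n p" "\<And>l. l < n \<Longrightarrow> xdvd l p"
    using LeastI[of "\<lambda>m. \<not> xdvd m p", OF m] not_less_Least[of _ "\<lambda>m. \<not> xdvd m p"]
    unfolding n_def by auto
  then obtain l where l: "n = Suc l" by (cases n) auto
  then obtain q where q: "p = smult (fps_X ^ l) q" using n(2)[of l] xdvdE by auto
  have "\<not> xdvd 1 q"
    using n(1) unfolding l q xdvd_def by (auto simp: mult_dvd_mono)
  then show thesis using that q by blast
qed

text \<open>Completeness of \<open>k[[X]]\<close>, coefficient by coefficient. The common bound on the degrees keeps the limit
a polynomial.\<close>

lemma xdvd_cauchy_limit: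
  fixes a :: "nat \<Rightarrow> 'k::field fps poly"
  assumes cauchy: "\<And>n. xdvd (Suc n) (a (Suc n) - a n)" and deg: "\<And>n i. i \<ge> d \<Longrightarrow> coeff (a n) i = 0"
  obtains l where "\<And>n. xdvd (Suc n) (l - a n)" "\<And>i. i \<ge> d \<Longrightarrow> coeff l i = 0"
proof -
  define l where "l = Abs_poly (\<lambda>i. Abs_fps (\<lambda>j. coeff (a j) i $ j))"
  have "Abs_fps (\<lambda>j. coeff (a j) i $ j) = 0" if "i > d" for i
    using that deg by (auto simp: fps_eq_iff)
  then have l: "coeff l i = Abs_fps (\<lambda>j. coeff (a j) i $ j)" for i
    unfolding l_def by (subst coeff_Abs_poly) auto
  have stab: "coeff (a n) i $ j = coeff (a j) i $ j" if "j \<le> n" for i j n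
    using that
  proof (induction rule: dec_induct)
    case (step n)
    then have "(coeff (a (Suc n)) i - coeff (a n) i) $ j = 0"
      using cauchy[of n] by (auto simp: xdvd_def fps_X_power_dvd_iff simp del: power_Suc)
    then show ?case using step by simp
  qed simp
  show thesis
  proof
    show "xdvd (Suc n) (l - a n)" for n
      using stab[of _ n] by (auto simp: xdvd_def fps_X_power_dvd_iff l simp del: power_Suc)
    show "coeff l i = 0" if "i \<ge> d" for i
      using deg[OF that] by (simp add: l fps_eq_iff)
  qed
qed

text \<open>Up to a unit factor on the left these are the monic polynomials of degree \<open>r\<close>.\<close>

definition unit_lead :: "nat \<Rightarrow> 'k::field fps poly \<Rightarrow> bool" where
  "unit_lead r p \<longleftrightarrow> coeff p r $ 0 \<noteq> 0 \<and> (\<forall>i>r. coeff p i = 0)"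

lemma unit_lead_inverse:
  assumes "unit_lead r p"
  obtains w where "w * coeff p r = 1"
  using assms inverse_mult_eq_1[of "coeff p r"] unfolding unit_lead_def by blast

text \<open>Cut off the terms above the last one whose coefficient is a unit; they are all divisible by \<open>X\<close>.\<close>

lemma unit_lead_truncation:
  assumes "\<not> xdvd 1 s"
  obtains r p where "unit_lead r p" "xdvd 1 (s - p)" "r \<le> degree s"
proof -
  define r where "r = Max {i. coeff s i $ 0 \<noteq> 0}"
  have sub: "{i. coeff s i $ 0 \<noteq> 0} \<subseteq> {..degree s}"
    by (auto intro!: le_degree)
  then have fin: "finite {i. coeff s i $ 0 \<noteq> 0}" using finite_subset by blast
  have ne: "{i. coeff s i $ 0 \<noteq> 0} \<noteq> {}"
    using assms by (auto simp: xdvd_def fps_X_dvd_iff)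
  have r: "coeff s r $ 0 \<noteq> 0" "\<And>i. i > r \<Longrightarrow> coeff s i $ 0 = 0"
    using Max_in[OF fin ne] Max_ge[OF fin] unfolding r_def by force+
  show thesis
  proof
    show "unit_lead r (poly_cutoff (Suc r) s)"
      using r(1) by (simp add: unit_lead_def coeff_poly_cutoff)
    show "xdvd 1 (s - poly_cutoff (Suc r) s)"
      using r(2) by (simp add: xdvd_def fps_X_dvd_iff coeff_poly_cutoff)
    show "r \<le> degree s" using r(1) by (intro le_degree) auto
  qed
qed

locale skew_fps =
  fixes \<alpha> :: "'k::field fps \<Rightarrow> 'k fps"
  assumes automorphism: "fps_algebra_automorphism \<alpha>"

sublocale skew_fps \<subseteq> skew_endo \<alpha>
  using automorphism by unfold_locales (auto simp: fps_algebra_automorphism_def)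

lemma fps_algebra_automorphism_inv:
  assumes "fps_algebra_automorphism \<alpha>"
  shows "fps_algebra_automorphism (inv_into UNIV \<alpha>)"
proof -
  have b: "bij \<alpha>" and a: "\<alpha> 1 = 1" "\<And>f g. \<alpha> (f + g) = \<alpha> f + \<alpha> g"
      "\<And>f g. \<alpha> (f * g) = \<alpha> f * \<alpha> g" "\<And>c f. \<alpha> (fps_const c * f) = fps_const c * \<alpha> f"
    using assms by (auto simp: fps_algebra_automorphism_def)
  have r: "\<alpha> (inv_into UNIV \<alpha> y) = y" for y using b by (metis bij_inv_eq_iff)
  have eq: "inv_into UNIV \<alpha> y = x" if "\<alpha> x = y" for x y
    using that b by (metis bij_inv_eq_iff)
  show ?thesis
    unfolding fps_algebra_automorphism_def
  proof (intro conjI allI)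
    show "inv_into UNIV \<alpha> (fps_const c * f) = fps_const c * inv_into UNIV \<alpha> f" for c f
      by (rule eq) (simp only: a(4) r)
  qed (auto intro!: eq simp: a(1-3) r b bij_imp_bij_inv)
qed

text \<open>Otherwise \<open>\<alpha>(X)\<close> is a unit, and applying the inverse automorphism makes \<open>X\<close> a unit.\<close>

lemma fps_X_dvd_automorphism:
  assumes "fps_algebra_automorphism \<alpha>"
  shows "fps_X dvd \<alpha> fps_X"
proof (rule ccontr)
  interpret i: skew_fps "inv_into UNIV \<alpha>"
    by unfold_locales (rule fps_algebra_automorphism_inv[OF assms])
  assume "\<not> fps_X dvd \<alpha> fps_X"
  then have "inverse (\<alpha> fps_X) * \<alpha> fps_X = 1"
    by (intro inverse_mult_eq_1) (simp add: fps_X_dvd_iff)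
  then have "inv_into UNIV \<alpha> (inverse (\<alpha> fps_X)) * inv_into UNIV \<alpha> (\<alpha> fps_X) = 1"
    using i.endo_mult i.endo_one by metis
  then have "inv_into UNIV \<alpha> (inverse (\<alpha> fps_X)) * fps_X = 1"
    using assms by (simp add: fps_algebra_automorphism_def bij_is_inj)
  then have "fps_X dvd (1 :: 'a fps)" by (metis dvd_triv_right)
  then show False by (simp add: fps_X_dvd_iff)
qed

context skew_fps
begin

notation skew_mult (infixl \<open>\<star>\<close> 70)

lemma bij_pow: "bij (\<alpha> ^^ i)"
  using automorphism by (intro bij_fn) (simp add: fps_algebra_automorphism_def)

lemma pow_eq_zero_iff [simp]: "(\<alpha> ^^ i) f = 0 \<longleftrightarrow> f = 0"
  using bij_is_inj[OF bij_pow[of i]] pow_zero[of i] by (metis injD)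

lemma pow_surj: obtains g where "(\<alpha> ^^ i) g = f"
  using bij_is_surj[OF bij_pow[of i]] by (metis surjD)

lemma fps_X_power_dvd_endo_iff: "fps_X ^ n dvd \<alpha> f \<longleftrightarrow> fps_X ^ n dvd f"
proof -
  have imp: "fps_X ^ n dvd \<beta> g" if aut: "fps_algebra_automorphism \<beta>" and dvd: "fps_X ^ n dvd g"
    for \<beta> :: "'k fps \<Rightarrow> 'k fps" and g
  proof -
    interpret b: skew_fps \<beta> by unfold_locales fact
    obtain h where "g = fps_X ^ n * h" using dvd by (elim dvdE)
    then have "\<beta> g = (\<beta> fps_X) ^ n * \<beta> h" using b.endo_mult b.pow_power[of 1] by simp
    then show ?thesis using fps_X_dvd_automorphism[OF aut] by (simp add: dvd_power_same)
  qed
  have "inv_into UNIV \<alpha> (\<alpha> f) = f"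
    using automorphism by (simp add: fps_algebra_automorphism_def bij_is_inj)
  then show ?thesis
    using imp[OF automorphism, of f] imp[OF fps_algebra_automorphism_inv[OF automorphism], of "\<alpha> f"]
    by auto
qed

lemma fps_X_power_dvd_pow_iff: "fps_X ^ n dvd (\<alpha> ^^ i) f \<longleftrightarrow> fps_X ^ n dvd f"
  by (induction i) (simp_all add: fps_X_power_dvd_endo_iff)

lemma pow_nth_0_iff: "(\<alpha> ^^ i) f $ 0 = 0 \<longleftrightarrow> f $ 0 = 0"
  using fps_X_power_dvd_pow_iff[of 1 i f] by (simp add: fps_X_dvd_iff)

lemma pow_fps_X_power:
  obtains w w' where "(\<alpha> ^^ i) (fps_X ^ n) = fps_X ^ n * w" "w' * w = 1"
proof -
  have "fps_X ^ n dvd (\<alpha> ^^ i) (fps_X ^ n)" by (simp add: fps_X_power_dvd_pow_iff)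
  then obtain w where w: "(\<alpha> ^^ i) (fps_X ^ n) = fps_X ^ n * w" by (elim dvdE)
  have "w $ 0 \<noteq> 0"
  proof
    assume "w $ 0 = 0"
    then have "fps_X ^ Suc n dvd (\<alpha> ^^ i) (fps_X ^ n)"
      unfolding w power_Suc2 by (intro mult_dvd_mono) (simp_all add: fps_X_dvd_iff)
    then have "fps_X ^ Suc n dvd (fps_X ^ n :: 'k fps)" by (simp only: fps_X_power_dvd_pow_iff)
    then show False by (simp add: fps_X_power_dvd_iff del: power_Suc) (metis lessI zero_neq_one)
  qed
  then have "inverse w * w = 1" by (rule inverse_mult_eq_1)
  with w show thesis using that by blast
qed

lemma xdvd_skew_mult:
  assumes "xdvd m p" "xdvd n q"
  shows "xdvd (m + n) (p \<star> q)"
  unfolding xdvd_def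
proof
  fix l
  show "fps_X ^ (m + n) dvd coeff (p \<star> q) l"
    unfolding coeff_skew_mult
  proof (rule dvd_sum)
    fix i
    have "fps_X ^ n dvd (\<alpha> ^^ i) (coeff q (l - i))"
      using assms(2) by (simp add: xdvd_def fps_X_power_dvd_pow_iff)
    then show "fps_X ^ (m + n) dvd coeff p i * (\<alpha> ^^ i) (coeff q (l - i))"
      using assms(1) unfolding power_add xdvd_def by (intro mult_dvd_mono) auto
  qed
qed

text \<open>The element \<open>\<alpha>\<^sup>i(X\<^sup>n)\<close> is \<open>X\<^sup>n\<close> times a unit, so powers of \<open>X\<close> can be moved across skew polynomials in
both directions: they are normal elements.\<close>

lemma fps_X_power_normal_left:
  obtains q where "p \<star> [:fps_X ^ n:] = [:fps_X ^ n:] \<star> q"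
proof -
  have "xdvd n [:fps_X ^ n :: 'k fps:]" by (simp add: xdvd_def coeff_pCons split: nat.split)
  then have "xdvd n (p \<star> [:fps_X ^ n:])" using xdvd_skew_mult[of 0 p n] by simp
  then show thesis using that xdvdE by (metis const_skew)
qed

lemma fps_X_power_normal_right:
  obtains q where "[:fps_X ^ n:] \<star> p = q \<star> [:fps_X ^ n:]"
proof -
  have "\<exists>q. smult (fps_X ^ n) p = q \<star> [:fps_X ^ n:]"
  proof (induction p rule: poly_additive_induct)
    case (1 a i)
    obtain w w' where w: "(\<alpha> ^^ i) (fps_X ^ n) = fps_X ^ n * w" "w' * w = 1"
      by (rule pow_fps_X_power)
    have "monom (a * w') i \<star> [:fps_X ^ n:] = monom (a * w' * (fps_X ^ n * w)) i"
      using w(1) monom_skew_monom[of "a * w'" i "fps_X ^ n" 0] by (simp add: monom_0)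
    also have "a * w' * (fps_X ^ n * w) = fps_X ^ n * a * (w' * w)" by (simp only: ac_simps)
    finally show ?case using w(2) by (metis smult_monom mult.right_neutral)
  next
    case (2 p q)
    then show ?case by (metis smult_add_right skew_add_left)
  qed
  then show thesis using that by (auto simp: const_skew)
qed

lemma unit_lead_skew_mult:
  assumes "unit_lead r p" "unit_lead s q"
  shows "unit_lead (r + s) (p \<star> q)"
proof -
  have "coeff (p \<star> q) (r + s) = coeff p r * (\<alpha> ^^ r) (coeff q s)"
    using assms by (intro coeff_skew_top) (auto simp: unit_lead_def)
  then have "coeff (p \<star> q) (r + s) $ 0 \<noteq> 0"
    using assms by (simp add: unit_lead_def pow_nth_0_iff)
  moreover have "degree p \<le> r" "degree q \<le> s"
    using assms by (auto simp: unit_lead_def intro: degree_le)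
  then have "degree (p \<star> q) \<le> r + s" using degree_skew_le[of p q] by simp
  ultimately show ?thesis by (auto simp: unit_lead_def intro: coeff_eq_0)
qed

lemma unit_lead_fps_X_commute:
  assumes "unit_lead r f"
  obtains g where "unit_lead r g" "f \<star> [:fps_X:] = [:fps_X:] \<star> g"
proof -
  obtain g where g: "f \<star> [:fps_X ^ 1:] = [:fps_X ^ 1:] \<star> g" by (rule fps_X_power_normal_left)
  obtain w w' where w: "(\<alpha> ^^ r) (fps_X ^ 1) = fps_X ^ 1 * w" "w' * w = 1"
    by (rule pow_fps_X_power)
  have coeffs: "coeff (f \<star> [:fps_X:]) i = fps_X * coeff g i" for i
    using g by (simp add: const_skew)
  have "coeff (f \<star> [:fps_X:]) (r + 0) = coeff f r * (\<alpha> ^^ r) (coeff [:fps_X:] 0)"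
    using assms by (intro coeff_skew_top) (auto simp: unit_lead_def coeff_pCons split: nat.split)
  then have "fps_X * coeff g r = fps_X * (w * coeff f r)"
    using w(1) coeffs[of r] by (simp add: ac_simps)
  then have "coeff g r = w * coeff f r" by (simp only: mult_left_cancel[OF fps_X_neq_zero])
  moreover have "w $ 0 \<noteq> 0" using arg_cong[OF w(2), of "\<lambda>f. f $ 0"] by auto
  ultimately have "coeff g r $ 0 \<noteq> 0" using assms by (simp add: unit_lead_def)
  moreover have "coeff g i = 0" if "i > r" for i
  proof -
    have "degree f \<le> r" using assms by (auto simp: unit_lead_def intro: degree_le)
    then have "coeff (f \<star> [:fps_X:]) i = 0"
      using that degree_skew_le[of f "[:fps_X:]"] by (intro coeff_eq_0) simp
    then show ?thesis using coeffs[of i] by simp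
  qed
  ultimately show thesis using that[of g] g by (simp add: unit_lead_def)
qed

lemma degree_skew_mult:
  assumes "p \<noteq> 0" "q \<noteq> 0"
  shows "degree (p \<star> q) = degree p + degree q" "p \<star> q \<noteq> 0"
proof -
  have "coeff (p \<star> q) (degree p + degree q) \<noteq> 0"
    using assms coeff_skew_top[of "degree p" p "degree q" q] by (simp add: coeff_eq_0)
  then show "degree (p \<star> q) = degree p + degree q" "p \<star> q \<noteq> 0"
    using degree_skew_le[of p q] by (auto intro!: antisym le_degree)
qed

lemma right_division:
  assumes "unit_lead r h"
  obtains q R where "s = q \<star> h + R" "\<forall>i\<ge>r. coeff R i = 0"
proof -
  have "\<exists>q R. s = q \<star> h + R \<and> (\<forall>i\<ge>r. coeff R i = 0)" if "\<And>i. i \<ge> d \<Longrightarrow> coeff s i = 0" for d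
    using that
  proof (induction d arbitrary: s)
    case 0
    then show ?case by (intro exI[of _ 0] exI[of _ s]) simp
  next
    case (Suc d)
    show ?case
    proof (cases "d < r")
      case True
      then show ?thesis using Suc.prems by (intro exI[of _ 0] exI[of _ s]) simp
    next
      case False
      obtain w where w: "w * coeff h r = 1" using unit_lead_inverse[OF assms] .
      define q1 where "q1 = monom (coeff s d * (\<alpha> ^^ (d - r)) w) (d - r)"
      have zero: "coeff (s - q1 \<star> h) i = 0" if "i \<ge> d" for i
      proof (cases "i = d")
        case True
        have "coeff (q1 \<star> h) d = coeff s d * (\<alpha> ^^ (d - r)) (w * coeff h r)"
          using False by (simp add: q1_def coeff_monom_skew pow_mult mult.assoc)
        then show ?thesis using True w by simp
      next
        case False
        then have "coeff s i = 0" "coeff h (i - (d - r)) = 0"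
          using that Suc.prems assms \<open>\<not> d < r\<close> by (auto simp: unit_lead_def)
        then show ?thesis by (simp add: q1_def coeff_monom_skew)
      qed
      from Suc.IH[OF zero] obtain q R where "s - q1 \<star> h = q \<star> h + R" "\<forall>i\<ge>r. coeff R i = 0"
        by blast
      then have "s = (q1 + q) \<star> h + R" "\<forall>i\<ge>r. coeff R i = 0"
        by (simp_all add: skew_add_left algebra_simps)
      then show ?thesis by blast
    qed
  qed
  from this[of "Suc (degree s)"] show thesis using that by (auto simp: coeff_eq_0)
qed

text \<open>Division with the divisor on the left. Solving for the leading coefficient of the quotient uses
that the powers of \<open>\<alpha>\<close> are onto, and as they preserve divisibility by \<open>X\<^sup>n\<close>, so does the division.
This last point is what makes the iteration in Hensel's lemma converge.\<close>

lemma left_division_xdvd: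
  assumes "unit_lead r h" "xdvd n g" "\<And>i. i \<ge> r + d \<Longrightarrow> coeff g i = 0"
  obtains q R where "g = h \<star> q + R" "xdvd n q" "xdvd n R"
    "\<And>i. i \<ge> r \<Longrightarrow> coeff R i = 0" "\<And>i. i \<ge> d \<Longrightarrow> coeff q i = 0"
proof -
  have "\<exists>q R. g = h \<star> q + R \<and> xdvd n q \<and> xdvd n R \<and> (\<forall>i\<ge>r. coeff R i = 0) \<and>
      (\<forall>i\<ge>d. coeff q i = 0)"
    using assms(2,3)
  proof (induction d arbitrary: g)
    case 0
    then show ?case by (intro exI[of _ 0] exI[of _ g]) simp
  next
    case (Suc d)
    obtain w where w: "w * coeff h r = 1" using unit_lead_inverse[OF assms(1)] .
    obtain b where b: "(\<alpha> ^^ r) b = w * coeff g (r + d)" by (rule pow_surj)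
    define q1 where "q1 = monom b d"
    have "fps_X ^ n dvd (\<alpha> ^^ r) b" using Suc.prems(1) by (simp add: b xdvd_def)
    then have q1: "xdvd n q1" by (simp add: fps_X_power_dvd_pow_iff xdvd_def q1_def)
    have x: "xdvd n (g - h \<star> q1)"
      using xdvd_skew_mult[OF xdvd_zero(1) q1] Suc.prems(1) by (auto intro: xdvd_diff)
    have zero: "coeff (g - h \<star> q1) i = 0" if "i \<ge> r + d" for i
    proof (cases "i = r + d")
      case True
      have "coeff (h \<star> q1) (r + d) = coeff h r * (\<alpha> ^^ r) (coeff q1 d)"
        using assms(1) by (intro coeff_skew_top) (auto simp: unit_lead_def q1_def)
      also have "\<dots> = (w * coeff h r) * coeff g (r + d)"
        by (simp add: q1_def b ac_simps)
      finally show ?thesis using True w by simp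
    next
      case False
      have "degree h \<le> r" "degree q1 \<le> d"
        using assms(1) by (auto simp: unit_lead_def q1_def degree_monom_le intro: degree_le)
      then have "degree (h \<star> q1) < i"
        using False that degree_skew_le[of h q1] by linarith
      then show ?thesis using Suc.prems(2)[of i] False that by (simp add: coeff_eq_0)
    qed
    obtain q R where qR: "g - h \<star> q1 = h \<star> q + R" "xdvd n q" "xdvd n R"
      "\<forall>i\<ge>r. coeff R i = 0" "\<forall>i\<ge>d. coeff q i = 0"
      using Suc.IH[OF x zero] by blast
    have "g = h \<star> (q1 + q) + R" using qR(1) by (simp add: skew_add_right algebra_simps)
    moreover have "xdvd n (q1 + q)" using q1 qR(2) by (rule xdvd_add)
    moreover have "\<forall>i\<ge>Suc d. coeff (q1 + q) i = 0" using qR(5) by (simp add: q1_def)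
    ultimately show ?case using qR(3,4) by blast
  qed
  then show thesis using that by blast
qed

text \<open>Modulo \<open>X\<close> the truncation \<open>h\<^sub>0\<close> of \<open>f\<close> gives the factorization \<open>f = h\<^sub>0 1\<close>. Given an approximate
factorization \<open>(h\<^sub>0 + a)(1 + b)\<close> with an error in \<open>X\<^sup>n\<^sup>+\<^sup>1S\<close>, dividing the error by \<open>h\<^sub>0\<close> gives a
quotient to be added to \<open>b\<close> and a remainder to be added to \<open>a\<close>; both lie in \<open>X\<^sup>n\<^sup>+\<^sup>1S\<close>. The new error is made of
products of two multiples of \<open>X\<close>, of which one is a correction, so it lies in \<open>X\<^sup>n\<^sup>+\<^sup>2S\<close>.\<close>

lemma hensel_factorization:
  assumes "\<not> xdvd 1 f"
  obtains r h u where "unit_lead r h" "xdvd 1 (u - 1)" "f = h \<star> u"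
proof -
  obtain r h0 where h0: "unit_lead r h0" "xdvd 1 (f - h0)" "r \<le> degree f"
    using unit_lead_truncation[OF assms] .
  define d where "d = Suc (degree f - r)"
  define err where "err a b = f - (h0 + a) \<star> (1 + b)" for a b
  define ok where "ok n ab \<longleftrightarrow> (case ab of (a, b) \<Rightarrow>
      xdvd 1 a \<and> xdvd 1 b \<and> (\<forall>i\<ge>r. coeff a i = 0) \<and> (\<forall>i\<ge>d. coeff b i = 0) \<and>
      xdvd (Suc n) (err a b))" for n ab
  define close where "close n ab cd \<longleftrightarrow> (case (ab, cd) of ((a, b), (c, d)) \<Rightarrow>
      xdvd (Suc n) (c - a) \<and> xdvd (Suc n) (d - b))"
    for n and ab cd :: "'k fps poly \<times> 'k fps poly"
  \<comment> \<open>the degree bounds in \<open>ok\<close> make the limits polynomials, \<open>close\<close> makes them exist\<close>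
  have "\<exists>g. \<forall>n. ok n (g n) \<and> close n (g n) (g (Suc n))"
  proof (rule dependent_nat_choice)
    show "\<exists>ab. ok 0 ab"
      by (rule exI[of _ "(0, 0)"]) (simp add: ok_def err_def h0(2)[unfolded One_nat_def])
  next
    fix ab n assume "ok n ab"
    then obtain a b where ab: "ab = (a, b)" "xdvd 1 a" "xdvd 1 b" "\<forall>i\<ge>r. coeff a i = 0"
      "\<forall>i\<ge>d. coeff b i = 0" "xdvd (Suc n) (err a b)"
      by (cases ab) (auto simp: ok_def)
    have zero: "coeff (err a b) i = 0" if "i \<ge> r + d" for i
    proof -
      have "degree (h0 + a) \<le> r" "degree (1 + b) \<le> degree f - r"
        using h0(1) ab(4,5) by (auto simp: unit_lead_def d_def intro!: degree_le)
      then have "degree ((h0 + a) \<star> (1 + b)) < i" "degree f < i"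
        using that degree_skew_le[of "h0 + a" "1 + b"] h0(3) by (auto simp: d_def)
      then show ?thesis by (simp add: err_def coeff_eq_0)
    qed
    obtain q R where qR: "err a b = h0 \<star> q + R" "xdvd (Suc n) q" "xdvd (Suc n) R"
      "\<And>i. i \<ge> r \<Longrightarrow> coeff R i = 0" "\<And>i. i \<ge> d \<Longrightarrow> coeff q i = 0"
      by (rule left_division_xdvd[OF h0(1) ab(6), of d]) (use zero in auto)
    have "err (a + R) (b + q) = err a b - (h0 \<star> q + R) - (a \<star> q + R \<star> b + R \<star> q)"
      by (simp add: err_def skew_add_left skew_add_right algebra_simps)
    also have "\<dots> = - (a \<star> q + R \<star> b + R \<star> q)" by (simp add: qR(1))
    finally have e: "err (a + R) (b + q) = - (a \<star> q + R \<star> b + R \<star> q)" .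
    have "xdvd (Suc (Suc n)) (a \<star> q)" "xdvd (Suc (Suc n)) (R \<star> b)" "xdvd (Suc (Suc n)) (R \<star> q)"
      using xdvd_skew_mult[OF ab(2) qR(2)] xdvd_skew_mult[OF qR(3) ab(3)]
        xdvd_skew_mult[OF qR(3) qR(2)] by (auto elim: xdvd_mono)
    then have "xdvd (Suc (Suc n)) (err (a + R) (b + q))"
      unfolding e by (intro xdvd_minus xdvd_add)
    moreover have "xdvd 1 q" "xdvd 1 R" using qR(2,3) by (auto elim: xdvd_mono)
    ultimately have "ok (Suc n) (a + R, b + q)"
      using ab qR(4,5) by (simp add: ok_def xdvd_add)
    moreover have "close n ab (a + R, b + q)"
      using qR(2,3) by (simp add: close_def ab(1))
    ultimately show "\<exists>cd. ok (Suc n) cd \<and> close n ab cd" by blast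
  qed
  then obtain g where g: "\<And>n. ok n (g n)" "\<And>n. close n (g n) (g (Suc n))" by blast
  define a b where "a n = fst (g n)" and "b n = snd (g n)" for n
  have ok: "xdvd 1 (a n)" "xdvd 1 (b n)" "i \<ge> r \<Longrightarrow> coeff (a n) i = 0" "i \<ge> d \<Longrightarrow> coeff (b n) i = 0"
    "xdvd (Suc n) (err (a n) (b n))" for n i
    using g(1)[of n] by (auto simp: ok_def a_def b_def split: prod.splits)
  have cl: "xdvd (Suc n) (a (Suc n) - a n)" "xdvd (Suc n) (b (Suc n) - b n)" for n
    using g(2)[of n] by (auto simp: close_def a_def b_def split: prod.splits)
  obtain a' where a': "\<And>n. xdvd (Suc n) (a' - a n)" "\<And>i. i \<ge> r \<Longrightarrow> coeff a' i = 0"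
    by (rule xdvd_cauchy_limit[of a r]) (use cl(1) ok(3) in auto)
  obtain b' where b': "\<And>n. xdvd (Suc n) (b' - b n)" "\<And>i. i \<ge> d \<Longrightarrow> coeff b' i = 0"
    by (rule xdvd_cauchy_limit[of b d]) (use cl(2) ok(4) in auto)
  have x: "xdvd (Suc n) (err a' b')" for n
  proof -
    have "err a' b' = err (a n) (b n) - (h0 + a') \<star> (b' - b n) - (a' - a n) \<star> (1 + b n)"
      by (simp add: err_def skew_add_left skew_add_right skew_diff_left skew_diff_right algebra_simps)
    moreover have "xdvd (Suc n) ((h0 + a') \<star> (b' - b n))" "xdvd (Suc n) ((a' - a n) \<star> (1 + b n))"
      using xdvd_skew_mult[OF xdvd_zero(1) b'(1)] xdvd_skew_mult[OF a'(1) xdvd_zero(1)] by simp_all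
    ultimately show ?thesis using ok(5)[of n] by (auto intro: xdvd_diff)
  qed
  have "xdvd n (err a' b')" for n using xdvd_mono[OF x[of n], of n] by simp
  then have "err a' b' = 0" by (rule xdvd_all_imp_zero)
  then have f: "f = (h0 + a') \<star> (1 + b')" by (simp add: err_def)
  have "coeff (h0 + a') r $ 0 \<noteq> 0" using h0(1) a'(2)[of r] by (simp add: unit_lead_def)
  then have "unit_lead r (h0 + a')" using h0(1) a'(2) by (simp add: unit_lead_def)
  moreover have "xdvd 1 (1 + b' - 1)"
    using xdvd_add[of 1 "b' - b 0" "b 0"] b'(1)[of 0] ok(2)[of 0] by simp
  ultimately show thesis using that f by blast
qed

end

section \<open>Chains of left ideals\<close>

text \<open>If \<open>(a, b) \<in> U\<close>, the elements of \<open>U\<close> not above \<open>(a, b)\<close> lie in the first \<open>a\<close> columns or the first \<open>b\<close>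
rows, and each column or row of \<open>U\<close> is dominated by its least element.\<close>

lemma dickson_pairs:
  fixes U :: "(nat \<times> nat) set"
  obtains G where "finite G" "G \<subseteq> U" "\<forall>(i, v)\<in>U. \<exists>(a, b)\<in>G. a \<le> i \<and> b \<le> v"
proof (cases "U = {}")
  case True
  then show thesis using that[of "{}"] by simp
next
  case False
  then obtain a b where ab: "(a, b) \<in> U" by auto
  define col where "col i = (i, LEAST v. (i, v) \<in> U)" for i
  define row where "row v = (LEAST i. (i, v) \<in> U, v)" for v
  define G where "G = insert (a, b) (col ` {..<a} \<union> row ` {..<b}) \<inter> U"
  show thesis
  proof
    show "finite G" by (simp add: G_def)
    show "G \<subseteq> U" by (simp add: G_def)
    have "\<exists>(a, b)\<in>G. a \<le> i \<and> b \<le> v" if iv: "(i, v) \<in> U" for i v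
    proof -
      have col: "col i \<in> U" "snd (col i) \<le> v"
        using LeastI[of "\<lambda>v. (i, v) \<in> U", OF iv] Least_le[of "\<lambda>v. (i, v) \<in> U", OF iv]
        by (auto simp: col_def)
      have row: "row v \<in> U" "fst (row v) \<le> i"
        using LeastI[of "\<lambda>i. (i, v) \<in> U", OF iv] Least_le[of "\<lambda>i. (i, v) \<in> U", OF iv]
        by (auto simp: row_def)
      show ?thesis
      proof (cases "i < a")
        case True
        then have "col i \<in> G" using col(1) by (auto simp: G_def)
        then show ?thesis using col(2) by (intro bexI[of _ "col i"]) (auto simp: col_def)
      next
        case False
        note ia = this
        show ?thesis
        proof (cases "v < b")
          case True
          then have "row v \<in> G" using row(1) by (auto simp: G_def)
          then show ?thesis using row(2) by (intro bexI[of _ "row v"]) (auto simp: row_def)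
        next
          case False
          then show ?thesis using ia ab by (intro bexI[of _ "(a, b)"]) (auto simp: G_def)
        qed
      qed
    qed
    then show "\<forall>(i, v)\<in>U. \<exists>(a, b)\<in>G. a \<le> i \<and> b \<le> v" by blast
  qed
qed

lemma upclosed_chain_stable:
  fixes U :: "nat \<Rightarrow> (nat \<times> nat) set"
  assumes up: "\<And>n i v. (i, v) \<in> U n \<Longrightarrow> (Suc i, v) \<in> U n \<and> (i, Suc v) \<in> U n"
    and inc: "\<And>n. U n \<subseteq> U (Suc n)"
  obtains n where "\<And>m. m \<ge> n \<Longrightarrow> U m = U n"
proof -
  have mono: "U n \<subseteq> U m" if "n \<le> m" for n m using that inc by (rule lift_Suc_mono_le[rotated])
  have up1: "(j, v) \<in> U n" if "i \<le> j" "(i, v) \<in> U n" for i j v n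
    using that by (induction rule: dec_induct) (simp_all add: up)
  have up2: "(i, w) \<in> U n" if "v \<le> w" "(i, v) \<in> U n" for i v w n
    using that by (induction rule: dec_induct) (simp_all add: up)
  obtain G where G: "finite G" "G \<subseteq> (\<Union>n. U n)"
    "\<forall>(i, v)\<in>\<Union>n. U n. \<exists>(a, b)\<in>G. a \<le> i \<and> b \<le> v"
    by (rule dickson_pairs[of "\<Union>n. U n"])
  have "\<exists>n. F \<subseteq> U n" if "finite F" "F \<subseteq> (\<Union>n. U n)" for F
    using that
  proof induction
    case (insert x F)
    then obtain n l where "F \<subseteq> U n" "x \<in> U l" by auto
    then have "insert x F \<subseteq> U (max n l)" using mono[of n "max n l"] mono[of l "max n l"] by auto
    then show ?case by blast
  qed simp
  then obtain n where n: "G \<subseteq> U n" using G by blast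
  have "(\<Union>n. U n) \<subseteq> U n"
  proof
    fix p assume p: "p \<in> (\<Union>n. U n)"
    obtain i v where iv: "p = (i, v)" by (cases p)
    obtain a b where "(a, b) \<in> U n" "a \<le> i" "b \<le> v"
      using G(3) p n unfolding iv by blast
    then show "p \<in> U n" unfolding iv using up1 up2 by blast
  qed
  then have "U m = U n" if "m \<ge> n" for m using mono[OF that] by blast
  then show thesis by (rule that)
qed

lemma bounded_nat_mono_stable:
  fixes d :: "nat \<Rightarrow> nat"
  assumes "\<And>n. d n \<le> d (Suc n)" "\<And>n. d n \<le> b"
  obtains n where "\<And>m. m \<ge> n \<Longrightarrow> d m = d n"
proof -
  have mono: "d n \<le> d m" if "n \<le> m" for n m using that assms(1) by (rule lift_Suc_mono_le[rotated])
  obtain n where "\<forall>m. d m \<le> d n"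
    using ex_has_greatest_nat[of "\<lambda>_. True" 0 d "Suc b"] assms(2) by (auto simp: less_Suc_eq_le)
  then have "d m = d n" if "m \<ge> n" for m using mono[OF that] by (simp add: antisym)
  then show thesis by (rule that)
qed

context skew_fps
begin

definition left_ideal :: "'k fps poly set \<Rightarrow> bool" where
  "left_ideal J \<longleftrightarrow> 0 \<in> J \<and> (\<forall>p\<in>J. \<forall>q\<in>J. p + q \<in> J) \<and> (\<forall>s. \<forall>p\<in>J. s \<star> p \<in> J)"

lemma left_ideal_add: "left_ideal J \<Longrightarrow> p \<in> J \<Longrightarrow> q \<in> J \<Longrightarrow> p + q \<in> J"
  by (simp add: left_ideal_def)

lemma left_ideal_mult: "left_ideal J \<Longrightarrow> p \<in> J \<Longrightarrow> s \<star> p \<in> J"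
  by (simp add: left_ideal_def)

lemma left_ideal_smult: "left_ideal J \<Longrightarrow> p \<in> J \<Longrightarrow> smult c p \<in> J"
  using left_ideal_mult[of J p "[:c:]"] by (simp add: const_skew)

lemma left_ideal_diff: "left_ideal J \<Longrightarrow> p \<in> J \<Longrightarrow> q \<in> J \<Longrightarrow> p - q \<in> J"
  using left_ideal_add[of J p "- q"] left_ideal_smult[of J q "-1"] by simp

text \<open>The analogue of the set of leading monomials in the theory of Groebner bases: since every nonzero
power series is a unit times a power of \<open>X\<close>, leading terms may be normalized to \<open>X\<^sup>v \<theta>\<^sup>i\<close>.\<close>

definition leading_exponents :: "'k fps poly set \<Rightarrow> (nat \<times> nat) set" where
  "leading_exponents J = {(i, v). \<exists>p\<in>J. (\<forall>l>i. coeff p l = 0) \<and> coeff p i = fps_X ^ v}"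

lemma leading_exponentsI:
  assumes "left_ideal J" "p \<in> J" "\<And>l. l > i \<Longrightarrow> coeff p l = 0" "coeff p i = fps_X ^ v * w" "w' * w = 1"
  shows "(i, v) \<in> leading_exponents J"
proof -
  have "coeff (smult w' p) i = fps_X ^ v * (w' * w)" by (simp add: assms(4) ac_simps)
  then show ?thesis
    using assms left_ideal_smult[OF assms(1,2), of w']
    unfolding leading_exponents_def by (auto intro!: bexI[of _ "smult w' p"])
qed

lemma leading_exponents_up:
  assumes J: "left_ideal J" and "(i, v) \<in> leading_exponents J"
  shows "(Suc i, v) \<in> leading_exponents J" "(i, Suc v) \<in> leading_exponents J"
proof -
  obtain p where p: "p \<in> J" "\<And>l. l > i \<Longrightarrow> coeff p l = 0" "coeff p i = fps_X ^ v"
    using assms(2) by (auto simp: leading_exponents_def)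
  show "(i, Suc v) \<in> leading_exponents J"
    by (rule leading_exponentsI[OF J left_ideal_smult[OF J p(1), of fps_X], of _ _ 1 1])
      (auto simp: p(2,3))
  obtain w w' where w: "(\<alpha> ^^ 1) (fps_X ^ v) = fps_X ^ v * w" "w' * w = 1"
    by (rule pow_fps_X_power)
  show "(Suc i, v) \<in> leading_exponents J"
    by (rule leading_exponentsI[OF J left_ideal_mult[OF J p(1), of "monom 1 1"], of _ _ w w'])
      (use p(2,3) w pow_zero[of 1] in \<open>auto simp: coeff_monom_skew\<close>)
qed

text \<open>An element of \<open>K\<close> can be reduced in degree by subtracting a multiple of an element of \<open>J\<close> with the
same leading exponents.\<close>

lemma left_ideal_eqI:
  assumes J: "left_ideal J" and K: "left_ideal K" and sub: "J \<subseteq> K"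
    and exps: "leading_exponents K \<subseteq> leading_exponents J"
  shows "J = K"
proof -
  have "p \<in> J" if "p \<in> K" "\<And>l. l \<ge> n \<Longrightarrow> coeff p l = 0" for n p
    using that
  proof (induction n arbitrary: p)
    case 0
    then have "p = 0" by (intro poly_eqI) simp
    then show ?case using J by (simp add: left_ideal_def)
  next
    case (Suc n)
    show ?case
    proof (cases "coeff p n = 0")
      case True
      have "coeff p l = 0" if "l \<ge> n" for l
        using Suc.prems(2)[of l] True that by (cases "l = n") auto
      then show ?thesis using Suc by blast
    next
      case False
      obtain v w w' where w: "coeff p n = fps_X ^ v * w" "w' * w = 1"
        using fps_X_power_unit_decomp[OF False] .
      have "(n, v) \<in> leading_exponents K"
        by (rule leading_exponentsI[OF K Suc.prems(1) _ w]) (simp add: Suc.prems(2))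
      then obtain g where g: "g \<in> J" "\<And>l. l > n \<Longrightarrow> coeff g l = 0" "coeff g n = fps_X ^ v"
        using exps unfolding leading_exponents_def by blast
      have "p - smult w g \<in> K"
        using g(1) sub Suc.prems(1) K by (blast intro: left_ideal_diff left_ideal_smult)
      moreover have "coeff (p - smult w g) l = 0" if "l \<ge> n" for l
        using that g(2)[of l] g(3) w(1) Suc.prems(2)[of l] by (cases "l = n") auto
      ultimately have "p - smult w g \<in> J" using Suc.IH by blast
      then have "(p - smult w g) + smult w g \<in> J"
        using g(1) J by (blast intro: left_ideal_add left_ideal_smult)
      then show ?thesis by simp
    qed
  qed
  then have "p \<in> J" if "p \<in> K" for p
    using that coeff_eq_0[of p] by (metis Suc_le_eq)
  then show ?thesis using sub by blast
qed

lemma leading_exponents_mono: "J \<subseteq> K \<Longrightarrow> leading_exponents J \<subseteq> leading_exponents K"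
  by (auto simp: leading_exponents_def)

lemma left_ideal_acc:
  assumes J: "\<And>n. left_ideal (J n)" and inc: "\<And>n. J n \<subseteq> J (Suc n)"
  obtains n where "\<And>m. m \<ge> n \<Longrightarrow> J m = J n"
proof -
  obtain n where n: "\<And>m. m \<ge> n \<Longrightarrow> leading_exponents (J m) = leading_exponents (J n)"
    by (rule upclosed_chain_stable[of "\<lambda>n. leading_exponents (J n)"])
      (use leading_exponents_up[OF J] leading_exponents_mono[OF inc] in auto)
  have mono: "J n \<subseteq> J m" if "n \<le> m" for n m using that inc by (rule lift_Suc_mono_le[rotated])
  have "J m = J n" if "m \<ge> n" for m
    using left_ideal_eqI[OF J J mono[OF that]] n[OF that] by simp
  then show thesis by (rule that)
qed

text \<open>The element \<open>f\<close> puts \<open>(r, 0)\<close> and \<open>X\<^sup>e\<close> puts \<open>(0, e)\<close> into all sets of leading exponents, so that their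
complements lie in a finite rectangle.\<close>

lemma left_ideal_dcc_finite_colength:
  assumes J: "\<And>n. left_ideal (J n)" and dec: "\<And>n. J (Suc n) \<subseteq> J n"
    and f: "unit_lead r f" "\<And>n. f \<in> J n" and X: "\<And>n. [:fps_X ^ e:] \<in> J n"
  obtains n where "\<And>m. m \<ge> n \<Longrightarrow> J m = J n"
proof -
  define C where "C n = - leading_exponents (J n)" for n
  have up1: "(i + l, v) \<in> leading_exponents (J n)" if "(i, v) \<in> leading_exponents (J n)" for i l v n
    using that by (induction l) (simp_all add: leading_exponents_up[OF J])
  have up2: "(i, v + l) \<in> leading_exponents (J n)" if "(i, v) \<in> leading_exponents (J n)" for i l v n
    using that by (induction l) (simp_all add: leading_exponents_up[OF J])
  have sub: "C n \<subseteq> {..<r} \<times> {..<e}" for n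
  proof -
    obtain w where w: "w * coeff f r = 1" using unit_lead_inverse[OF f(1)] .
    have "(r, 0) \<in> leading_exponents (J n)"
      by (rule leading_exponentsI[OF J f(2) _ _ w]) (use f(1) in \<open>auto simp: unit_lead_def\<close>)
    then have 1: "(i, v) \<in> leading_exponents (J n)" if "i \<ge> r" for i v
      using up1[of r v n "i - r"] up2[of r 0 n v] that by simp
    have "(0, e) \<in> leading_exponents (J n)"
      by (rule leading_exponentsI[OF J X, of _ _ 1 1]) (auto simp: coeff_pCons split: nat.split)
    then have 2: "(i, v) \<in> leading_exponents (J n)" if "v \<ge> e" for i v
      using up1[of 0 v n i] up2[of 0 e n "v - e"] that by simp
    show ?thesis
    proof
      fix p assume p: "p \<in> C n"
      obtain i v where iv: "p = (i, v)" by (cases p)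
      then have "\<not> i \<ge> r" "\<not> v \<ge> e" using p 1 2 unfolding C_def by blast+
      then show "p \<in> {..<r} \<times> {..<e}" by (simp add: iv)
    qed
  qed
  have fin: "finite (C n)" for n by (rule finite_subset[OF sub]) simp
  have Cinc: "C n \<subseteq> C (Suc n)" for n using leading_exponents_mono[OF dec] by (auto simp: C_def)
  obtain n where n: "\<And>m. m \<ge> n \<Longrightarrow> card (C m) = card (C n)"
    by (rule bounded_nat_mono_stable[of "\<lambda>n. card (C n)" "card ({..<r} \<times> {..<e})"])
      (use card_mono[OF fin Cinc] card_mono[OF _ sub] in auto)
  have "J m = J n" if "m \<ge> n" for m
  proof -
    have "C n \<subseteq> C m" using that Cinc by (rule lift_Suc_mono_le[rotated])
    then have "C n = C m" using n[OF that] fin by (intro card_subset_eq) auto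
    then have "leading_exponents (J n) \<subseteq> leading_exponents (J m)" by (auto simp: C_def)
    moreover have "J m \<subseteq> J n" using that dec by (rule lift_Suc_antimono_le[rotated])
    ultimately show ?thesis by (intro left_ideal_eqI J)
  qed
  then show thesis by (rule that)
qed

definition min_degree :: "'k fps poly set \<Rightarrow> nat" where
  "min_degree J = (LEAST d. \<exists>p\<in>J. p \<noteq> 0 \<and> degree p = d)"

lemma min_degree_le: "p \<in> J \<Longrightarrow> p \<noteq> 0 \<Longrightarrow> min_degree J \<le> degree p"
  unfolding min_degree_def by (rule Least_le) blast

lemma min_degree_attained:
  assumes "p \<in> J" "p \<noteq> 0"
  obtains g where "g \<in> J" "g \<noteq> 0" "degree g = min_degree J"
  using LeastI[of "\<lambda>d. \<exists>p\<in>J. p \<noteq> 0 \<and> degree p = d" "degree p"] assms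
  unfolding min_degree_def by blast

text \<open>After inverting \<open>X\<close> the coefficients form a field, and degrees alone determine the reduction: an
element of \<open>K\<close> is brought to lower degree by cross-multiplying leading coefficients with an element
of \<open>J\<close>. The leading coefficient by which it was multiplied is a unit times a power of \<open>X\<close>, which can
be removed again as \<open>J\<close> is saturated.\<close>

lemma saturated_left_ideal_eqI:
  assumes J: "left_ideal J" and K: "left_ideal K" and sub: "J \<subseteq> K"
    and sat: "\<And>p. smult fps_X p \<in> J \<Longrightarrow> p \<in> J"
    and g: "g \<in> J" "g \<noteq> 0" and eq: "min_degree K = degree g"
  shows "J = K"
proof -
  have sat': "p \<in> J" if "smult (fps_X ^ v) p \<in> J" for v p
    using that by (induction v) (auto intro: sat simp flip: smult_smult)
  have "p \<in> J" if "p \<in> K" "degree p < n" for n p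
    using that
  proof (induction n arbitrary: p)
    case (Suc n)
    show ?case
    proof (cases "p = 0")
      case True
      then show ?thesis using J by (simp add: left_ideal_def)
    next
      case False
      have le: "degree g \<le> degree p" using min_degree_le[OF Suc.prems(1) False] eq by simp
      define h where "h = monom 1 (degree p - degree g) \<star> g"
      have m: "monom 1 (degree p - degree g) \<noteq> (0 :: 'k fps poly)" by simp
      have h: "h \<in> J" "h \<noteq> 0" "degree h = degree p"
        using left_ideal_mult[OF J g(1)] degree_skew_mult[OF m g(2)] le
        by (auto simp: h_def degree_monom_eq)
      define c where "c = coeff h (degree p)"
      have c: "c \<noteq> 0" using h(2,3) leading_coeff_neq_0[of h] by (simp add: c_def)
      define q where "q = smult c p - smult (coeff p (degree p)) h"
      have q: "q \<in> K" unfolding q_def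
        using h(1) sub Suc.prems(1) K by (blast intro: left_ideal_diff left_ideal_smult)
      have "q \<in> J"
      proof (cases "q = 0")
        case True
        then show ?thesis using J by (simp add: left_ideal_def)
      next
        case False
        have "coeff q i = 0" if "i \<ge> degree p" for i
          using that h(3) by (cases "i = degree p") (auto simp: q_def c_def coeff_eq_0)
        then have "degree q < degree p" using False by (metis leading_coeff_0_iff not_le)
        then show ?thesis using Suc.IH q Suc.prems(2) by simp
      qed
      then have "q + smult (coeff p (degree p)) h \<in> J"
        using h(1) J by (blast intro: left_ideal_add left_ideal_smult)
      then have cp: "smult c p \<in> J" by (simp add: q_def)
      obtain v w w' where w: "c = fps_X ^ v * w" "w' * w = 1"
        using fps_X_power_unit_decomp[OF c] .
      have "smult w' (smult c p) \<in> J" using left_ideal_smult[OF J cp] .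
      moreover have "w' * c = fps_X ^ v" using w by (metis mult.left_commute mult.right_neutral)
      ultimately have "smult (fps_X ^ v) p \<in> J" by simp
      then show ?thesis by (rule sat')
    qed
  qed simp
  then show ?thesis using sub by blast
qed

text \<open>The least degree of a nonzero element increases along the chain and is bounded by the degree of \<open>u\<close>;
for saturated ideals it decides equality.\<close>

lemma left_ideal_dcc_saturated:
  assumes J: "\<And>n. left_ideal (J n)" and dec: "\<And>n. J (Suc n) \<subseteq> J n"
    and sat: "\<And>n p. smult fps_X p \<in> J n \<Longrightarrow> p \<in> J n" and u: "u \<noteq> 0" "\<And>n. u \<in> J n"
  obtains n where "\<And>m. m \<ge> n \<Longrightarrow> J m = J n"
proof -
  have le: "min_degree (J n) \<le> min_degree (J (Suc n))" for n
  proof -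
    obtain g where "g \<in> J (Suc n)" "g \<noteq> 0" "degree g = min_degree (J (Suc n))"
      using min_degree_attained[OF u(2,1)] .
    then show ?thesis using min_degree_le[of g "J n"] dec[of n] by auto
  qed
  obtain n where n: "\<And>m. m \<ge> n \<Longrightarrow> min_degree (J m) = min_degree (J n)"
    by (rule bounded_nat_mono_stable[of "\<lambda>n. min_degree (J n)" "degree u"])
      (use le min_degree_le[OF u(2,1)] in auto)
  have "J m = J n" if "m \<ge> n" for m
  proof -
    obtain g where g: "g \<in> J m" "g \<noteq> 0" "degree g = min_degree (J m)"
      using min_degree_attained[OF u(2,1)] .
    have "J m \<subseteq> J n" using that dec by (rule lift_Suc_antimono_le[rotated])
    then show ?thesis
      by (rule saturated_left_ideal_eqI[OF J J _ sat g(1,2)]) (use g(3) n[OF that] in auto)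
  qed
  then show thesis by (rule that)
qed

end

section \<open>Modules over skew polynomial rings\<close>

locale skew_fps_module = skew_fps \<alpha> + plain_left_module "skew_poly_ring \<alpha>" M
  for \<alpha> :: "'k::field fps \<Rightarrow> 'k fps" and M :: "('k fps poly, 'b) module" (structure)
begin

abbreviation act (infixr \<open>\<bullet>\<close> 75) where "p \<bullet> x \<equiv> p \<odot>\<^bsub>M\<^esub> x"

lemma skew_poly_ring_simps [simp]:
  "carrier (skew_poly_ring \<alpha>) = UNIV" "add (skew_poly_ring \<alpha>) = (+)"
  "monoid.mult (skew_poly_ring \<alpha>) = skew_poly_mult \<alpha>"
  "one (skew_poly_ring \<alpha>) = 1" "zero (skew_poly_ring \<alpha>) = 0"
  by (simp_all add: skew_poly_ring_def)

lemma act_closed [simp]: "x \<in> carrier M \<Longrightarrow> p \<bullet> x \<in> carrier M"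
  using lsmult_closed[of p x] by simp

lemma act_add: "x \<in> carrier M \<Longrightarrow> (p + q) \<bullet> x = p \<bullet> x \<oplus>\<^bsub>M\<^esub> q \<bullet> x"
  using lsmult_l_distr[of p q x] by simp

lemma act_add_right:
  "x \<in> carrier M \<Longrightarrow> y \<in> carrier M \<Longrightarrow> p \<bullet> (x \<oplus>\<^bsub>M\<^esub> y) = p \<bullet> x \<oplus>\<^bsub>M\<^esub> p \<bullet> y"
  using lsmult_r_distr[of p x y] by simp

lemma act_mult: "x \<in> carrier M \<Longrightarrow> (p \<star> q) \<bullet> x = p \<bullet> q \<bullet> x"
  using lsmult_assoc[of p q x] by simp

lemma act_one [simp]: "x \<in> carrier M \<Longrightarrow> 1 \<bullet> x = x"
  using lsmult_one[of x] by simp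

lemma act_zero [simp]: "x \<in> carrier M \<Longrightarrow> 0 \<bullet> x = \<zero>\<^bsub>M\<^esub>"
  using lsmult_zero_left[of x] by simp

lemma act_zero_right [simp]: "p \<bullet> \<zero>\<^bsub>M\<^esub> = \<zero>\<^bsub>M\<^esub>"
  using lsmult_zero_right[of p] by simp

lemma act_diff_eq_zero:
  assumes "x \<in> carrier M" "p \<bullet> x = q \<bullet> x"
  shows "(p - q) \<bullet> x = \<zero>\<^bsub>M\<^esub>"
proof -
  have "(p - q) \<bullet> x \<oplus>\<^bsub>M\<^esub> q \<bullet> x = q \<bullet> x"
    using act_add[of x "p - q" q] assms by simp
  then show ?thesis using assms(1) by (simp add: M.add.r_cancel_one)
qed

lemma cyclic_eq: "cyclic m = range (\<lambda>p. p \<bullet> m)"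
  by (auto simp: cyclic_def)

text \<open>Submodules of a cyclic module \<open>Sm\<close> are compared through the left ideals that they pull back to along
\<open>p \<mapsto> p m\<close>.\<close>

definition transporter :: "'b set \<Rightarrow> 'b \<Rightarrow> 'k fps poly set" where
  "transporter H m = {p. p \<bullet> m \<in> H}"

lemma left_ideal_transporter:
  assumes "submodule H (skew_poly_ring \<alpha>) M" "m \<in> carrier M"
  shows "left_ideal (transporter H m)"
  using submoduleD[OF assms(1)] assms(2)
  by (simp add: left_ideal_def transporter_def act_add act_mult)

lemma transporter_eq_imp_eq:
  assumes "H \<subseteq> cyclic m" "K \<subseteq> cyclic m" "transporter H m = transporter K m"
  shows "H = K"
  using assms by (fastforce simp: transporter_def cyclic_eq)

lemma cyclic_module_noetherian:
  assumes m: "m \<in> carrier M" and gen: "carrier M = cyclic m"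
  shows "noetherian_module (skew_poly_ring \<alpha>) M"
  unfolding noetherian_module_def
proof (intro conjI allI impI)
  fix H :: "nat \<Rightarrow> 'b set"
  assume H: "(\<forall>n. submodule (H n) (skew_poly_ring \<alpha>) M) \<and> (\<forall>n. H n \<subseteq> H (Suc n))"
  obtain n where n: "\<And>l. l \<ge> n \<Longrightarrow> transporter (H l) m = transporter (H n) m"
    by (rule left_ideal_acc[of "\<lambda>n. transporter (H n) m"])
      (use H left_ideal_transporter[OF _ m] in \<open>auto simp: transporter_def\<close>)
  have sub: "H l \<subseteq> cyclic m" for l using H submoduleD(1) gen by blast
  have "H l = H n" if "l \<ge> n" for l using transporter_eq_imp_eq[OF sub sub n[OF that]] .
  then show "\<exists>n. \<forall>l\<ge>n. H l = H n" by blast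
qed (rule left_module_axioms)

lemma dcc_below_cyclic_finite_colength:
  assumes m: "m \<in> carrier M" and f: "unit_lead r f" "f \<bullet> m = \<zero>\<^bsub>M\<^esub>"
    and e: "[:fps_X ^ e:] \<bullet> m = \<zero>\<^bsub>M\<^esub>"
  shows "dcc_below (cyclic m)"
  unfolding dcc_below_def
proof (intro allI impI)
  fix H :: "nat \<Rightarrow> 'b set"
  assume H: "\<forall>n. submodule (H n) (skew_poly_ring \<alpha>) M \<and> H n \<subseteq> cyclic m"
    and dec: "\<forall>n. H (Suc n) \<subseteq> H n"
  have "\<zero>\<^bsub>M\<^esub> \<in> H n" for n using H submoduleD(2) by blast
  then obtain n where n: "\<And>l. l \<ge> n \<Longrightarrow> transporter (H l) m = transporter (H n) m"
    by (rule_tac left_ideal_dcc_finite_colength[of "\<lambda>n. transporter (H n) m" r f e])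
      (use H dec f e left_ideal_transporter[OF _ m] in \<open>auto simp: transporter_def\<close>)
  have "H l = H n" if "l \<ge> n" for l
    by (rule transporter_eq_imp_eq[OF _ _ n[OF that]]) (use H in auto)
  then show "\<exists>n. \<forall>l\<ge>n. H l = H n" by blast
qed

lemma dcc_below_cyclic_saturated:
  assumes m: "m \<in> carrier M" and u: "u \<noteq> 0" "u \<bullet> m = \<zero>\<^bsub>M\<^esub>"
    and sat: "\<And>H x. submodule H (skew_poly_ring \<alpha>) M \<Longrightarrow> x \<in> carrier M \<Longrightarrow>
      [:fps_X:] \<bullet> x \<in> H \<Longrightarrow> x \<in> H"
  shows "dcc_below (cyclic m)"
  unfolding dcc_below_def
proof (intro allI impI)
  fix H :: "nat \<Rightarrow> 'b set"
  assume H: "\<forall>n. submodule (H n) (skew_poly_ring \<alpha>) M \<and> H n \<subseteq> cyclic m"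
    and dec: "\<forall>n. H (Suc n) \<subseteq> H n"
  have z: "u \<in> transporter (H n) m" for n
    using H submoduleD(2) u(2) by (auto simp: transporter_def)
  have s: "p \<in> transporter (H n) m" if "smult fps_X p \<in> transporter (H n) m" for n p
    using sat[of "H n" "p \<bullet> m"] H that m
    by (simp add: transporter_def act_mult[OF m, symmetric] const_skew)
  obtain n where n: "\<And>l. l \<ge> n \<Longrightarrow> transporter (H l) m = transporter (H n) m"
    by (rule left_ideal_dcc_saturated[of "\<lambda>n. transporter (H n) m" u])
      (use H dec u(1) z s left_ideal_transporter[OF _ m] in \<open>auto simp: transporter_def\<close>)
  have "H l = H n" if "l \<ge> n" for l
    by (rule transporter_eq_imp_eq[OF _ _ n[OF that]]) (use H in auto)
  then show "\<exists>n. \<forall>l\<ge>n. H l = H n" by blast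
qed

lemma submodule_fps_X_image:
  assumes "submodule H (skew_poly_ring \<alpha>) M"
  shows "submodule ((\<lambda>x. [:fps_X:] \<bullet> x) ` H) (skew_poly_ring \<alpha>) M"
proof -
  note H = submoduleD[OF assms]
  have car: "x \<in> carrier M" if "x \<in> H" for x using H(1) that by blast
  show ?thesis
  proof (rule submoduleI)
    show "\<zero>\<^bsub>M\<^esub> \<in> (\<lambda>x. [:fps_X:] \<bullet> x) ` H" using H(2) act_zero_right by (metis imageI)
    show "x \<oplus>\<^bsub>M\<^esub> y \<in> (\<lambda>x. [:fps_X:] \<bullet> x) ` H"
      if "x \<in> (\<lambda>x. [:fps_X:] \<bullet> x) ` H" "y \<in> (\<lambda>x. [:fps_X:] \<bullet> x) ` H" for x y
      using that H(3) car by (auto simp: act_add_right[symmetric])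
    fix p x assume "x \<in> (\<lambda>x. [:fps_X:] \<bullet> x) ` H"
    then obtain z where z: "z \<in> H" "x = [:fps_X:] \<bullet> z" by blast
    obtain q where "p \<star> [:fps_X ^ 1:] = [:fps_X ^ 1:] \<star> q" by (rule fps_X_power_normal_left)
    then have "p \<bullet> x = [:fps_X:] \<bullet> (q \<bullet> z)"
      using z car by (simp flip: act_mult)
    then show "p \<bullet> x \<in> (\<lambda>x. [:fps_X:] \<bullet> x) ` H" using H(4)[of q z] z(1) by simp
  qed (use car in auto)
qed

definition fps_X_torsion :: "nat \<Rightarrow> 'b set" where
  "fps_X_torsion n = {x \<in> carrier M. [:fps_X ^ n:] \<bullet> x = \<zero>\<^bsub>M\<^esub>}"

lemma submodule_fps_X_torsion: "submodule (fps_X_torsion n) (skew_poly_ring \<alpha>) M"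
proof (rule submoduleI)
  fix p x assume x: "x \<in> fps_X_torsion n"
  then have xc: "x \<in> carrier M" by (simp add: fps_X_torsion_def)
  obtain q where q: "[:fps_X ^ n:] \<star> p = q \<star> [:fps_X ^ n:]" by (rule fps_X_power_normal_right)
  have "[:fps_X ^ n:] \<bullet> (p \<bullet> x) = q \<bullet> ([:fps_X ^ n:] \<bullet> x)"
    by (simp only: act_mult[OF xc, symmetric] q)
  then show "p \<bullet> x \<in> fps_X_torsion n" using x by (simp add: fps_X_torsion_def)
qed (auto simp: fps_X_torsion_def act_add_right)

lemma fps_X_power_Suc_act:
  "x \<in> carrier M \<Longrightarrow> [:fps_X ^ Suc n:] \<bullet> x = [:fps_X:] \<bullet> [:fps_X ^ n:] \<bullet> x"
  "x \<in> carrier M \<Longrightarrow> [:fps_X ^ Suc n:] \<bullet> x = [:fps_X ^ n:] \<bullet> [:fps_X:] \<bullet> x"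
  by (simp_all add: const_skew mult.commute flip: act_mult)

end

section \<open>Essential extensions of simple modules\<close>

locale essential_simple_submodule = skew_fps_module +
  fixes V
  assumes V_submodule: "submodule V (skew_poly_ring \<alpha>) M"
    and V_nonzero: "V \<noteq> {\<zero>\<^bsub>M\<^esub>}"
    and V_minimal: "submodule H (skew_poly_ring \<alpha>) M \<Longrightarrow> H \<subseteq> V \<Longrightarrow> H = {\<zero>\<^bsub>M\<^esub>} \<or> H = V"
    and V_essential: "submodule H (skew_poly_ring \<alpha>) M \<Longrightarrow> H \<inter> V = {\<zero>\<^bsub>M\<^esub>} \<Longrightarrow> H = {\<zero>\<^bsub>M\<^esub>}"
begin

lemma V_carrier: "v \<in> V \<Longrightarrow> v \<in> carrier M"
  using submoduleD(1)[OF V_submodule] by blast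

lemma V_act: "v \<in> V \<Longrightarrow> p \<bullet> v \<in> V"
  using submoduleD(4)[OF V_submodule, of p v] by simp

lemma obtain_nonzero:
  obtains v where "v \<in> V" "v \<noteq> \<zero>\<^bsub>M\<^esub>"
  using V_nonzero submoduleD(2)[OF V_submodule] by blast

text \<open>Being simple and essential, \<open>V\<close> is the least nonzero submodule.\<close>

lemma V_subset_cyclic:
  assumes "y \<in> carrier M" "y \<noteq> \<zero>\<^bsub>M\<^esub>"
  shows "V \<subseteq> cyclic y"
proof -
  have "cyclic y \<inter> V = {\<zero>\<^bsub>M\<^esub>} \<or> cyclic y \<inter> V = V"
    using submodule_Int[OF cyclic_submodule[OF assms(1)] V_submodule] by (intro V_minimal) auto
  then show ?thesis
    using V_essential[OF cyclic_submodule[OF assms(1)]] mem_cyclic[OF assms(1)] assms(2) by auto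
qed

lemma V_mem_act:
  assumes "y \<in> carrier M" "y \<noteq> \<zero>\<^bsub>M\<^esub>" "v \<in> V"
  obtains p where "v = p \<bullet> y"
  using V_subset_cyclic[OF assms(1,2)] assms(3) by (auto simp: cyclic_eq)

text \<open>The \<open>X\<^sup>n\<close>-torsion parts of \<open>Sm\<close> stabilize at some \<open>n\<close>. If \<open>X\<^sup>n m\<close> were nonzero, then a nonzero
\<open>v \<in> V\<close> would be \<open>p X\<^sup>n m = X\<^sup>n q m\<close>. As \<open>X v = 0\<close>, the element \<open>q m\<close> is \<open>X\<^sup>n\<^sup>+\<^sup>1\<close>-torsion, so it is already
\<open>X\<^sup>n\<close>-torsion and \<open>v = 0\<close>.\<close>

lemma torsion_case_fps_X_nilpotent:
  assumes XV: "\<And>v. v \<in> V \<Longrightarrow> [:fps_X:] \<bullet> v = \<zero>\<^bsub>M\<^esub>" and m: "m \<in> carrier M"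
  obtains n where "[:fps_X ^ n:] \<bullet> m = \<zero>\<^bsub>M\<^esub>"
proof -
  have inc: "fps_X_torsion n \<subseteq> fps_X_torsion (Suc n)" for n
    unfolding fps_X_torsion_def using fps_X_power_Suc_act(1) by fastforce
  obtain n where n: "\<And>l. l \<ge> n \<Longrightarrow> transporter (fps_X_torsion l) m = transporter (fps_X_torsion n) m"
    by (rule left_ideal_acc[of "\<lambda>n. transporter (fps_X_torsion n) m"])
      (use left_ideal_transporter[OF submodule_fps_X_torsion m] inc in \<open>auto simp: transporter_def\<close>)
  have "[:fps_X ^ n:] \<bullet> m = \<zero>\<^bsub>M\<^esub>"
  proof (rule ccontr)
    assume nz: "[:fps_X ^ n:] \<bullet> m \<noteq> \<zero>\<^bsub>M\<^esub>"
    obtain v where v: "v \<in> V" "v \<noteq> \<zero>\<^bsub>M\<^esub>" by (rule obtain_nonzero)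
    obtain p where p: "v = p \<bullet> [:fps_X ^ n:] \<bullet> m" using V_mem_act[OF _ nz v(1)] m by auto
    obtain q where "p \<star> [:fps_X ^ n:] = [:fps_X ^ n:] \<star> q" by (rule fps_X_power_normal_left)
    then have q: "v = [:fps_X ^ n:] \<bullet> q \<bullet> m" using p m by (simp flip: act_mult)
    then have "[:fps_X ^ Suc n:] \<bullet> q \<bullet> m = \<zero>\<^bsub>M\<^esub>"
      using XV[OF v(1)] m by (simp only: fps_X_power_Suc_act act_closed)
    then have "q \<in> transporter (fps_X_torsion (Suc n)) m"
      using m by (simp add: transporter_def fps_X_torsion_def)
    then have "q \<in> transporter (fps_X_torsion n) m" using n[of "Suc n"] by simp
    then show False using q v(2) by (simp add: transporter_def fps_X_torsion_def)
  qed
  then show thesis by (rule that)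
qed

lemma xdvd_act_fps_X_killed:
  assumes "x \<in> carrier M" "[:fps_X:] \<bullet> x = \<zero>\<^bsub>M\<^esub>" "xdvd 1 s"
  shows "s \<bullet> x = \<zero>\<^bsub>M\<^esub>"
proof -
  obtain t where t: "s = smult (fps_X ^ 1) t" using xdvdE[OF assms(3)] .
  have "t \<bullet> x \<in> fps_X_torsion 1"
    using submoduleD(4)[OF submodule_fps_X_torsion, of t x 1] assms by (simp add: fps_X_torsion_def)
  then show ?thesis
    using t assms(1) act_mult[of x "[:fps_X:]" t] by (simp add: fps_X_torsion_def const_skew)
qed

text \<open>On an element killed by \<open>X\<close> the ring acts through \<open>k[\<theta>]\<close>, where nonzero polynomials have invertible
leading coefficients.\<close>

lemma fps_X_killed_act_unit_lead:
  assumes x: "x \<in> carrier M" "[:fps_X:] \<bullet> x = \<zero>\<^bsub>M\<^esub>" and s: "\<not> xdvd 1 s"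
  obtains r p where "unit_lead r p" "p \<bullet> x = s \<bullet> x"
proof -
  obtain r p where p: "unit_lead r p" "xdvd 1 (s - p)" using unit_lead_truncation[OF s] .
  have "s \<bullet> x = (p + (s - p)) \<bullet> x" by simp
  also have "\<dots> = p \<bullet> x" using x xdvd_act_fps_X_killed[OF x p(2)] by (simp only: act_add) simp
  finally show thesis using that p(1) by simp
qed

text \<open>For \<open>X m = 0\<close> this happens over \<open>k[\<theta>]\<close>: some \<open>p\<close> maps \<open>m\<close> to a nonzero \<open>v \<in> V\<close>, and \<open>v\<close> is killed by
\<open>\<theta>\<close>, or else \<open>v \<in> S \<theta> v\<close>, so that \<open>v\<close> is killed by some \<open>t \<theta> - 1\<close>. In general an annihilator
\<open>f\<close> of \<open>X m\<close> is given by induction. Moving \<open>X\<close> to the left in \<open>f X = X g\<close> shows that \<open>g m\<close> is killed by \<open>X\<close>,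
and the first case applies to \<open>g m\<close>.\<close>

lemma torsion_case_unit_lead_annihilator:
  assumes XV: "\<And>v. v \<in> V \<Longrightarrow> [:fps_X:] \<bullet> v = \<zero>\<^bsub>M\<^esub>"
    and "m \<in> carrier M" "[:fps_X ^ n:] \<bullet> m = \<zero>\<^bsub>M\<^esub>"
  shows "\<exists>r f. unit_lead r f \<and> f \<bullet> m = \<zero>\<^bsub>M\<^esub>"
  using assms(2,3)
proof (induction n arbitrary: m)
  case 0
  then have "1 \<bullet> m = \<zero>\<^bsub>M\<^esub>" by (simp add: one_pCons)
  then show ?case by (intro exI[of _ 0] exI[of _ 1]) (simp add: unit_lead_def)
next
  case (Suc n)
  have base: "\<exists>r f. unit_lead r f \<and> f \<bullet> x = \<zero>\<^bsub>M\<^esub>"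
    if x: "x \<in> carrier M" "[:fps_X:] \<bullet> x = \<zero>\<^bsub>M\<^esub>" for x
  proof (cases "x = \<zero>\<^bsub>M\<^esub>")
    case True
    then show ?thesis by (intro exI[of _ 0] exI[of _ 1]) (simp add: unit_lead_def)
  next
    case False
    obtain v where v: "v \<in> V" "v \<noteq> \<zero>\<^bsub>M\<^esub>" by (rule obtain_nonzero)
    obtain s where s: "v = s \<bullet> x" using V_mem_act[OF x(1) False v(1)] .
    have "\<not> xdvd 1 s" using xdvd_act_fps_X_killed[OF x] s v(2) by blast
    then obtain r p where p: "unit_lead r p" "p \<bullet> x = s \<bullet> x"
      using fps_X_killed_act_unit_lead[OF x] by blast
    have "\<exists>l q. unit_lead l q \<and> q \<bullet> v = \<zero>\<^bsub>M\<^esub>"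
    proof (cases "monom 1 1 \<bullet> v = \<zero>\<^bsub>M\<^esub>")
      case True
      then show ?thesis by (intro exI[of _ 1] exI[of _ "monom 1 1"]) (simp add: unit_lead_def)
    next
      case False
      obtain t where t: "v = t \<bullet> monom 1 1 \<bullet> v"
        using V_mem_act[OF _ False v(1)] V_carrier[OF v(1)] by auto
      have "(t \<star> monom 1 1) \<bullet> v = 1 \<bullet> v"
        using t V_carrier[OF v(1)] by (simp add: act_mult)
      then have kill: "(t \<star> monom 1 1 - 1) \<bullet> v = \<zero>\<^bsub>M\<^esub>"
        using act_diff_eq_zero V_carrier[OF v(1)] by blast
      have "coeff (t \<star> monom 1 1 - 1) 0 = - 1" by (simp add: coeff_skew_mult)
      then have "\<not> fps_X ^ 1 dvd coeff (t \<star> monom 1 1 - 1) 0"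
        by (simp only: fps_X_power_dvd_iff) simp
      then have "\<not> xdvd 1 (t \<star> monom 1 1 - 1)" unfolding xdvd_def by blast
      then obtain l q where "unit_lead l q" "q \<bullet> v = (t \<star> monom 1 1 - 1) \<bullet> v"
        using fps_X_killed_act_unit_lead[OF V_carrier[OF v(1)] XV[OF v(1)]] by blast
      then show ?thesis using kill by auto
    qed
    then obtain l q where q: "unit_lead l q" "q \<bullet> v = \<zero>\<^bsub>M\<^esub>" by blast
    have "(q \<star> p) \<bullet> x = \<zero>\<^bsub>M\<^esub>" using q(2) p(2) s x(1) by (simp add: act_mult)
    then show ?thesis using unit_lead_skew_mult[OF q(1) p(1)] by blast
  qed
  have "[:fps_X ^ n:] \<bullet> [:fps_X:] \<bullet> m = \<zero>\<^bsub>M\<^esub>"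
    using Suc.prems by (simp only: fps_X_power_Suc_act(2))
  then obtain r f where f: "unit_lead r f" "f \<bullet> [:fps_X:] \<bullet> m = \<zero>\<^bsub>M\<^esub>"
    using Suc.IH[of "[:fps_X:] \<bullet> m"] Suc.prems(1) by auto
  obtain g where g: "unit_lead r g" "f \<star> [:fps_X:] = [:fps_X:] \<star> g"
    using unit_lead_fps_X_commute[OF f(1)] .
  have "[:fps_X:] \<bullet> g \<bullet> m = \<zero>\<^bsub>M\<^esub>"
    using f(2) g(2) Suc.prems(1) by (metis act_mult)
  then obtain l h where h: "unit_lead l h" "h \<bullet> g \<bullet> m = \<zero>\<^bsub>M\<^esub>"
    using base[of "g \<bullet> m"] Suc.prems(1) by auto
  then have "(h \<star> g) \<bullet> m = \<zero>\<^bsub>M\<^esub>" using Suc.prems(1) by (simp add: act_mult)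
  then show ?case using unit_lead_skew_mult[OF h(1) g(1)] by blast
qed

lemma divisible_case_fps_X_injective:
  assumes XV: "\<And>v. v \<in> V \<Longrightarrow> \<exists>w\<in>V. v = [:fps_X:] \<bullet> w"
    and "x \<in> carrier M" "[:fps_X ^ n:] \<bullet> x = \<zero>\<^bsub>M\<^esub>"
  shows "x = \<zero>\<^bsub>M\<^esub>"
proof -
  have "fps_X_torsion 1 \<inter> V \<noteq> V"
  proof
    assume "fps_X_torsion 1 \<inter> V = V"
    then have "v = \<zero>\<^bsub>M\<^esub>" if "v \<in> V" for v
      using XV[OF that] by (auto simp: fps_X_torsion_def)
    then show False using obtain_nonzero by blast
  qed
  then have "fps_X_torsion 1 \<inter> V = {\<zero>\<^bsub>M\<^esub>}"
    using V_minimal[OF submodule_Int[OF submodule_fps_X_torsion[of 1] V_submodule]] by blast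
  then have "fps_X_torsion 1 = {\<zero>\<^bsub>M\<^esub>}" by (rule V_essential[OF submodule_fps_X_torsion])
  then have inj: "y = \<zero>\<^bsub>M\<^esub>" if "y \<in> carrier M" "[:fps_X:] \<bullet> y = \<zero>\<^bsub>M\<^esub>" for y
    using that by (auto simp: fps_X_torsion_def)
  show ?thesis using assms(2,3)
  proof (induction n arbitrary: x)
    case 0
    then show ?case using act_one[of x] by (simp add: one_pCons)
  next
    case (Suc n)
    then have "[:fps_X ^ n:] \<bullet> [:fps_X:] \<bullet> x = \<zero>\<^bsub>M\<^esub>" by (simp only: fps_X_power_Suc_act(2))
    then have "[:fps_X:] \<bullet> x = \<zero>\<^bsub>M\<^esub>" using Suc.IH[of "[:fps_X:] \<bullet> x"] Suc.prems(1) by simp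
    then show ?case by (rule inj[OF Suc.prems(1)])
  qed
qed

text \<open>A nonzero \<open>v \<in> V\<close> has the form \<open>X w\<close> with \<open>w \<in> V = Sv\<close>, so \<open>X t - 1\<close> kills it for some \<open>t\<close>. Composing with
an element that maps \<open>m\<close> to \<open>v\<close> gives an annihilator of \<open>m\<close>, nonzero because \<open>S\<close> is a domain.\<close>

lemma divisible_case_annihilator_nonzero:
  assumes XV: "\<And>v. v \<in> V \<Longrightarrow> \<exists>w\<in>V. v = [:fps_X:] \<bullet> w" and m: "m \<in> carrier M"
  obtains f where "f \<noteq> 0" "f \<bullet> m = \<zero>\<^bsub>M\<^esub>"
proof (cases "m = \<zero>\<^bsub>M\<^esub>")
  case True
  then show thesis using that[of 1] by simp
next
  case False
  obtain v where v: "v \<in> V" "v \<noteq> \<zero>\<^bsub>M\<^esub>" by (rule obtain_nonzero)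
  obtain s where s: "v = s \<bullet> m" using V_mem_act[OF m False v(1)] .
  obtain w where w: "w \<in> V" "v = [:fps_X:] \<bullet> w" using XV[OF v(1)] by blast
  obtain t where t: "w = t \<bullet> v" using V_mem_act[OF V_carrier[OF v(1)] v(2) w(1)] .
  define u where "u = [:fps_X:] \<star> t - 1"
  have "([:fps_X:] \<star> t) \<bullet> v = 1 \<bullet> v"
    using w(2) t V_carrier[OF v(1)] by (simp add: act_mult)
  then have "u \<bullet> v = \<zero>\<^bsub>M\<^esub>" unfolding u_def using act_diff_eq_zero V_carrier[OF v(1)] by blast
  then have "(u \<star> s) \<bullet> m = \<zero>\<^bsub>M\<^esub>" using s m by (simp add: act_mult)
  moreover have "coeff u 0 $ 0 = - 1" by (simp add: u_def const_skew)
  then have "u \<noteq> 0" by auto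
  moreover have "s \<noteq> 0" using s v(2) m by auto
  ultimately show thesis using that degree_skew_mult(2) by blast
qed

text \<open>With the factorization \<open>f = h u\<close> of an annihilator of least degree, \<open>y = u m\<close> is killed by \<open>h\<close>, and the
least degree makes \<open>y, \<theta> y, \<dots>, \<theta>\<^sup>r\<^sup>-\<^sup>1 y\<close> linearly independent over \<open>k[[X]]\<close>. If \<open>y \<noteq> 0\<close>, then \<open>V \<subseteq> Sy\<close>, and for
every \<open>n\<close> a nonzero \<open>v \<in> V\<close> is \<open>X\<^sup>n\<close> times an element of \<open>V\<close>. By independence the coordinates of \<open>v\<close>
are divisible by all powers of \<open>X\<close>, a contradiction.\<close>

lemma divisible_case_annihilator_one_mod_fps_X:
  assumes XV: "\<And>v. v \<in> V \<Longrightarrow> \<exists>w\<in>V. v = [:fps_X:] \<bullet> w" and m: "m \<in> carrier M"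
  obtains u where "xdvd 1 (u - 1)" "u \<bullet> m = \<zero>\<^bsub>M\<^esub>"
proof -
  define I where "I = transporter {\<zero>\<^bsub>M\<^esub>} m"
  have I: "p \<in> I \<longleftrightarrow> p \<bullet> m = \<zero>\<^bsub>M\<^esub>" for p by (simp add: I_def transporter_def)
  obtain g0 where "g0 \<noteq> 0" "g0 \<bullet> m = \<zero>\<^bsub>M\<^esub>"
    using divisible_case_annihilator_nonzero[OF XV m] by blast
  then obtain g where g: "g \<in> I" "g \<noteq> 0" "degree g = min_degree I"
    using min_degree_attained I by blast
  obtain n f where f: "g = smult (fps_X ^ n) f" "\<not> xdvd 1 f" using nonzero_primitive_part[OF g(2)] .
  have "[:fps_X ^ n:] \<bullet> f \<bullet> m = \<zero>\<^bsub>M\<^esub>"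
    using g(1) f(1) m by (simp add: I const_skew flip: act_mult)
  then have fm: "f \<bullet> m = \<zero>\<^bsub>M\<^esub>" using divisible_case_fps_X_injective[OF XV] m by simp
  have degf: "degree f = min_degree I" using g(3) f(1) by simp
  obtain r h u where u: "unit_lead r h" "xdvd 1 (u - 1)" "f = h \<star> u"
    using hensel_factorization[OF f(2)] .
  have nz: "h \<noteq> 0" "u \<noteq> 0" using u(3) f(2) by (auto simp: xdvd_def)
  have "degree h = r"
    using u(1) by (intro antisym degree_le le_degree) (auto simp: unit_lead_def)
  then have deg: "min_degree I = r + degree u"
    using degree_skew_mult(1)[OF nz] u(3) degf by simp
  define y where "y = u \<bullet> m"
  have y: "y \<in> carrier M" "h \<bullet> y = \<zero>\<^bsub>M\<^esub>"
    using m fm u(3) by (simp_all add: y_def flip: act_mult)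
  \<comment> \<open>linear independence: a relation \<open>D\<close> would make \<open>D u\<close> an annihilator of \<open>m\<close> of smaller degree\<close>
  have small: "D = 0" if "D \<bullet> y = \<zero>\<^bsub>M\<^esub>" "\<And>i. i \<ge> r \<Longrightarrow> coeff D i = 0" for D
  proof (rule ccontr)
    assume D: "D \<noteq> 0"
    then have "degree D < r" using that(2) by (metis leading_coeff_0_iff not_le)
    moreover have "D \<star> u \<in> I" using that(1) m by (simp add: I y_def act_mult)
    then have "min_degree I \<le> degree D + degree u"
      using min_degree_le degree_skew_mult[OF D nz(2)] by metis
    ultimately show False using deg by simp
  qed
  have rep: "\<exists>R. v = R \<bullet> y \<and> (\<forall>i\<ge>r. coeff R i = 0)" if ny: "y \<noteq> \<zero>\<^bsub>M\<^esub>" and vV: "v \<in> V" for v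
  proof -
    obtain s where s: "v = s \<bullet> y" using V_mem_act[OF y(1) ny vV] .
    obtain q R where R: "s = q \<star> h + R" "\<forall>i\<ge>r. coeff R i = 0"
      using right_division[OF u(1), where s = s] .
    have "v = R \<bullet> y" using y by (simp add: s R(1) act_add act_mult)
    then show ?thesis using R(2) by blast
  qed
  have div: "\<exists>w\<in>V. v = [:fps_X ^ n:] \<bullet> w" if "v \<in> V" for v n
    using that
  proof (induction n arbitrary: v)
    case 0
    then have "v = [:fps_X ^ 0:] \<bullet> v" using act_one[OF V_carrier[OF 0]] by (simp add: one_pCons)
    then show ?case using 0 by blast
  next
    case (Suc n)
    obtain w where w: "w \<in> V" "v = [:fps_X:] \<bullet> w" using XV[OF Suc.prems] by blast
    obtain z where "z \<in> V" "w = [:fps_X ^ n:] \<bullet> z" using Suc.IH[OF w(1)] by blast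
    then have "v = [:fps_X ^ Suc n:] \<bullet> z"
      using w(2) by (simp only: fps_X_power_Suc_act(1)[OF V_carrier])
    then show ?case using \<open>z \<in> V\<close> by blast
  qed
  have "y = \<zero>\<^bsub>M\<^esub>"
  proof (rule ccontr)
    assume ny: "y \<noteq> \<zero>\<^bsub>M\<^esub>"
    obtain v where v: "v \<in> V" "v \<noteq> \<zero>\<^bsub>M\<^esub>" by (rule obtain_nonzero)
    obtain R0 where R0: "v = R0 \<bullet> y" "\<forall>i\<ge>r. coeff R0 i = 0" using rep[OF ny v(1)] by blast
    have "xdvd n R0" for n
    proof -
      obtain w where w: "w \<in> V" "v = [:fps_X ^ n:] \<bullet> w" using div[OF v(1)] by blast
      obtain R where R: "w = R \<bullet> y" "\<forall>i\<ge>r. coeff R i = 0" using rep[OF ny w(1)] by blast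
      have "R0 \<bullet> y = smult (fps_X ^ n) R \<bullet> y"
        using R0(1) w(2) R(1) act_mult[OF y(1), of "[:fps_X ^ n:]" R] by (simp add: const_skew)
      then have "(R0 - smult (fps_X ^ n) R) \<bullet> y = \<zero>\<^bsub>M\<^esub>" by (rule act_diff_eq_zero[OF y(1)])
      then have "R0 - smult (fps_X ^ n) R = 0" by (rule small) (simp add: R0(2) R(2))
      then show ?thesis using xdvd_smult[of n R] by simp
    qed
    then have "R0 = 0" by (rule xdvd_all_imp_zero)
    then show False using R0(1) v(2) y(1) by simp
  qed
  then show thesis using that u(2) by (simp add: y_def)
qed

text \<open>An annihilator of \<open>x\<close> that is \<open>1\<close> modulo \<open>X\<close> exhibits \<open>x\<close> as an element of \<open>XSx = SXx\<close>.\<close>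

lemma divisible_case_saturated:
  assumes XV: "\<And>v. v \<in> V \<Longrightarrow> \<exists>w\<in>V. v = [:fps_X:] \<bullet> w"
    and H: "submodule H (skew_poly_ring \<alpha>) M" and x: "x \<in> carrier M" "[:fps_X:] \<bullet> x \<in> H"
  shows "x \<in> H"
proof -
  obtain u where u: "xdvd 1 (u - 1)" "u \<bullet> x = \<zero>\<^bsub>M\<^esub>"
    using divisible_case_annihilator_one_mod_fps_X[OF XV x(1)] by blast
  obtain t where t: "u - 1 = smult (fps_X ^ 1) t" using xdvdE[OF u(1)] .
  obtain q where q: "[:fps_X ^ 1:] \<star> (- t) = q \<star> [:fps_X ^ 1:]" by (rule fps_X_power_normal_right)
  have u': "u = 1 + smult fps_X t" using t by (simp add: algebra_simps)
  have q': "q \<star> [:fps_X:] = - smult fps_X t" using q by (simp add: const_skew)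
  have "1 = u + q \<star> [:fps_X:]" by (simp add: u' q')
  then have "1 \<bullet> x = u \<bullet> x \<oplus>\<^bsub>M\<^esub> (q \<star> [:fps_X:]) \<bullet> x" using act_add[OF x(1)] by metis
  then have "x = q \<bullet> [:fps_X:] \<bullet> x" using x(1) u(2) by (simp add: act_mult)
  then show ?thesis using submoduleD(4)[OF H, of q "[:fps_X:] \<bullet> x"] x(2) by simp
qed

lemma cyclic_dcc:
  assumes m: "m \<in> carrier M"
  shows "dcc_below (cyclic m)"
proof -
  let ?XV = "(\<lambda>v. [:fps_X:] \<bullet> v) ` V"
  have "?XV \<subseteq> V" using V_act by blast
  then consider "?XV = {\<zero>\<^bsub>M\<^esub>}" | "?XV = V"
    using V_minimal[OF submodule_fps_X_image[OF V_submodule]] by blast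
  then show ?thesis
  proof cases
    case 1
    then have XV: "[:fps_X:] \<bullet> v = \<zero>\<^bsub>M\<^esub>" if "v \<in> V" for v using that by blast
    obtain n where n: "[:fps_X ^ n:] \<bullet> m = \<zero>\<^bsub>M\<^esub>"
      using torsion_case_fps_X_nilpotent[OF XV m] by blast
    then obtain r f where "unit_lead r f" "f \<bullet> m = \<zero>\<^bsub>M\<^esub>"
      using torsion_case_unit_lead_annihilator[OF XV m] by blast
    then show ?thesis using dcc_below_cyclic_finite_colength m n by blast
  next
    case 2
    then have XV: "\<exists>w\<in>V. v = [:fps_X:] \<bullet> w" if "v \<in> V" for v using that by blast
    obtain u where u: "xdvd 1 (u - 1)" "u \<bullet> m = \<zero>\<^bsub>M\<^esub>"
      using divisible_case_annihilator_one_mod_fps_X[OF XV m] by blast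
    have "u \<noteq> 0"
    proof
      assume "u = 0"
      moreover have "fps_X ^ 1 dvd coeff (u - 1) 0" using u(1) unfolding xdvd_def by blast
      ultimately show False by (simp add: fps_X_dvd_iff)
    qed
    then show ?thesis
      by (rule dcc_below_cyclic_saturated[OF m _ u(2)]) (rule divisible_case_saturated[OF XV])
  qed
qed

end

section \<open>Left and right modules\<close>

lemma ring_opposite_ring:
  assumes "ring R"
  shows "ring (opposite_ring R)"
proof -
  interpret ring R by fact
  have [simp]: "carrier (opposite_ring R) = carrier R" "add (opposite_ring R) = add R"
    "zero (opposite_ring R) = zero R" "one (opposite_ring R) = one R"
    "x \<otimes>\<^bsub>opposite_ring R\<^esub> y = y \<otimes>\<^bsub>R\<^esub> x" for x y
    by (simp_all add: opposite_ring_def)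
  show ?thesis
  proof (rule ringI)
    show "abelian_group (opposite_ring R)"
      by (rule abelian_groupI) (auto simp: a_ac intro: l_neg)
    show "monoid (opposite_ring R)"
      by (rule monoidI) (auto simp: m_assoc)
  qed (auto simp: l_distr r_distr)
qed

lemma left_module_regular_module:
  assumes "ring R"
  shows "left_module R (regular_module R)"
proof -
  interpret ring R by fact
  have "abelian_group (regular_module R)"
    by (rule abelian_groupI) (auto simp: regular_module_def a_ac intro: l_neg)
  then show ?thesis
    using ring_axioms
    by (auto intro!: left_module.intro left_module_axioms.intro
        simp: regular_module_def l_distr r_distr m_assoc)
qed

lemma (in skew_fps) essential_extension_locally_artinian:
  fixes S :: "('k fps poly, 's) module" and E :: "('k fps poly, 'e) module"
  assumes simple: "simple_module (skew_poly_ring \<alpha>) S"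
    and E: "left_module (skew_poly_ring \<alpha>) E"
    and hom: "\<iota> \<in> lmodule_hom (skew_poly_ring \<alpha>) S E" and inj: "inj_on \<iota> (carrier S)"
    and ess: "essential_submodule (skew_poly_ring \<alpha>) E (\<iota> ` carrier S)"
  shows "locally_artinian (skew_poly_ring \<alpha>) E"
proof -
  let ?R = "skew_poly_ring \<alpha>" and ?V = "\<iota> ` carrier S"
  have "left_module ?R S" using simple by (simp add: simple_module_def)
  then interpret S: plain_left_module ?R S by (rule plain_left_module.intro)
  interpret E: skew_fps_module \<alpha> E
    by (intro skew_fps_module.intro skew_fps_axioms plain_left_module.intro E)
  have closed: "\<iota> x \<in> carrier E" if "x \<in> carrier S" for x
    using hom that by (auto simp: lmodule_hom_def)
  have add: "\<iota> (x \<oplus>\<^bsub>S\<^esub> y) = \<iota> x \<oplus>\<^bsub>E\<^esub> \<iota> y" if "x \<in> carrier S" "y \<in> carrier S" for x y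
    using hom that by (auto simp: lmodule_hom_def)
  have smult: "\<iota> (p \<odot>\<^bsub>S\<^esub> x) = p \<odot>\<^bsub>E\<^esub> \<iota> x" if "x \<in> carrier S" for p x
    using hom that by (auto simp: lmodule_hom_def)
  have zero: "\<iota> \<zero>\<^bsub>S\<^esub> = \<zero>\<^bsub>E\<^esub>"
    using smult[of "\<zero>\<^bsub>S\<^esub>" 0] S.lsmult_zero_right[of 0] closed[of "\<zero>\<^bsub>S\<^esub>"] by simp
  have V: "submodule ?V ?R E" using ess by (simp add: essential_submodule_def)
  have nonzero: "?V \<noteq> {\<zero>\<^bsub>E\<^esub>}"
  proof
    assume *: "?V = {\<zero>\<^bsub>E\<^esub>}"
    have "x = \<zero>\<^bsub>S\<^esub>" if "x \<in> carrier S" for x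
      using inj_onD[OF inj, of x "\<zero>\<^bsub>S\<^esub>"] * that zero by auto
    then show False using simple by (auto simp: simple_module_def)
  qed
  have minimal: "H = {\<zero>\<^bsub>E\<^esub>} \<or> H = ?V" if H: "submodule H ?R E" "H \<subseteq> ?V" for H
  proof -
    let ?K = "{x \<in> carrier S. \<iota> x \<in> H}"
    note HD = E.submoduleD[OF H(1)]
    have "submodule ?K ?R S"
      using HD(2-4) by (intro S.submoduleI) (auto simp: zero add smult S.lsmult_closed)
    then have "?K = {\<zero>\<^bsub>S\<^esub>} \<or> ?K = carrier S" using simple by (simp add: simple_module_def)
    moreover have "H = \<iota> ` ?K" using H(2) by auto
    ultimately show ?thesis using zero by auto
  qed
  interpret E: essential_simple_submodule \<alpha> E ?V
  proof (intro essential_simple_submodule.intro essential_simple_submodule_axioms.intro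
      E.skew_fps_module_axioms V nonzero)
    show "H = {\<zero>\<^bsub>E\<^esub>} \<or> H = ?V" if "submodule H ?R E" "H \<subseteq> ?V" for H
      using that by (rule minimal)
    show "H = {\<zero>\<^bsub>E\<^esub>}" if "submodule H ?R E" "H \<inter> ?V = {\<zero>\<^bsub>E\<^esub>}" for H
      using ess that by (simp add: essential_submodule_def)
  qed
  show ?thesis by (rule E.locally_artinianI) (rule E.cyclic_dcc)
qed

lemma (in skew_fps) noetherian_regular_module:
  "noetherian_module (skew_poly_ring \<alpha>) (regular_module (skew_poly_ring \<alpha>))"
proof -
  interpret M: skew_fps_module \<alpha> "regular_module (skew_poly_ring \<alpha>)"
    by (intro skew_fps_module.intro skew_fps_axioms plain_left_module.intro
        left_module_regular_module ring_skew_poly_ring)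
  have "M.cyclic 1 = UNIV"
    unfolding M.cyclic_eq by (simp add: regular_module_def skew_poly_ring_def)
  moreover have "carrier (regular_module (skew_poly_ring \<alpha>)) = UNIV"
    by (simp add: regular_module_def skew_poly_ring_def)
  ultimately show ?thesis by (intro M.cyclic_module_noetherian[of 1]) simp_all
qed

text \<open>Right modules over the skew polynomial ring of \<open>\<alpha>\<close> become left modules over that of the inverse
of \<open>\<alpha>\<close>.\<close>

lemma scalar_change_opposite_skew_poly_ring:
  assumes "fps_algebra_automorphism \<alpha>"
  shows "scalar_change (skew_poly_ring (inv_into UNIV \<alpha>)) (opposite_ring (skew_poly_ring \<alpha>))
    (twist_coeffs \<alpha>)"
proof -
  interpret skew_fps \<alpha> by unfold_locales fact
  interpret i: skew_fps "inv_into UNIV \<alpha>"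
    by unfold_locales (rule fps_algebra_automorphism_inv[OF assms])
  have inv: "\<alpha> (inv_into UNIV \<alpha> a) = a" for a
    using assms by (simp add: fps_algebra_automorphism_def bij_is_surj surj_f_inv_f)
  have "twist_coeffs \<alpha> \<in> ring_hom (skew_poly_ring (inv_into UNIV \<alpha>)) (opposite_ring (skew_poly_ring \<alpha>))"
    using twist_coeffs_skew_mult[OF i.skew_endo_axioms inv]
    by (intro ring_hom_memI)
      (auto simp: skew_poly_ring_def opposite_ring_def twist_coeffs_add twist_coeffs_one)
  moreover have "range (twist_coeffs \<alpha>) = UNIV"
    using surj_twist_coeffs[OF i.skew_endo_axioms inv] .
  ultimately show ?thesis
    by (intro scalar_change.intro scalar_change_axioms.intro i.ring_skew_poly_ring
        ring_opposite_ring ring_skew_poly_ring)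
      (auto simp: skew_poly_ring_def opposite_ring_def)
qed

theorem theorem1p4:
  fixes \<alpha> :: "'k::field fps \<Rightarrow> 'k fps"
  assumes "fps_algebra_automorphism \<alpha>"
    and "infinite_order \<alpha>"
  shows "satisfies_diamond TYPE('s) TYPE('e) (skew_poly_ring \<alpha>)"
proof -
  let ?A = "skew_poly_ring \<alpha>" and ?B = "skew_poly_ring (inv_into UNIV \<alpha>)"
  interpret skew_fps \<alpha> by unfold_locales fact
  interpret i: skew_fps "inv_into UNIV \<alpha>"
    by unfold_locales (rule fps_algebra_automorphism_inv[OF assms(1)])
  interpret op: scalar_change ?B "opposite_ring ?A" "twist_coeffs \<alpha>"
    by (rule scalar_change_opposite_skew_poly_ring[OF assms(1)])
  have "noetherian_module (opposite_ring ?A) (regular_module (opposite_ring ?A))"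
  proof -
    let ?M = "regular_module (opposite_ring ?A)"
    have M: "left_module (opposite_ring ?A) ?M"
      by (intro left_module_regular_module ring_opposite_ring ring_skew_poly_ring)
    interpret M: skew_fps_module "inv_into UNIV \<alpha>" "restrict_scalars (twist_coeffs \<alpha>) ?M"
      by (intro skew_fps_module.intro i.skew_fps_axioms plain_left_module.intro
          op.left_module_restrict M)
    \<comment> \<open>after the change of scalars the regular module is still generated by \<open>1\<close>\<close>
    have "M.cyclic 1 = range (twist_coeffs \<alpha>)"
      unfolding M.cyclic_eq by (simp add: regular_module_def opposite_ring_def skew_poly_ring_def)
    also have "\<dots> = UNIV" using op.onto by (simp add: opposite_ring_def skew_poly_ring_def)
    finally have "M.cyclic 1 = UNIV" .
    moreover have "carrier (restrict_scalars (twist_coeffs \<alpha>) ?M) = UNIV"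
      by (simp add: regular_module_def opposite_ring_def skew_poly_ring_def)
    ultimately have "noetherian_module ?B (restrict_scalars (twist_coeffs \<alpha>) ?M)"
      by (intro M.cyclic_module_noetherian[of 1]) simp_all
    then show ?thesis by (rule op.noetherian_restrict[OF M])
  qed
  then have "two_sided_noetherian ?A"
    unfolding two_sided_noetherian_def using ring_skew_poly_ring noetherian_regular_module by blast
  moreover have "left_diamond TYPE('s) TYPE('e) ?A"
    unfolding left_diamond_def
  proof (intro allI impI, elim conjE)
    fix S :: "('k fps poly, 's) module" and E :: "('k fps poly, 'e) module" and \<iota>
    assume S: "simple_module ?A S" and "injective_hull ?A S E \<iota>"
    then have "left_module ?A E" "\<iota> \<in> lmodule_hom ?A S E" "inj_on \<iota> (carrier S)"
        "essential_submodule ?A E (\<iota> ` carrier S)"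
      unfolding injective_hull_def injective_module_def by blast+
    then show "locally_artinian ?A E" by (rule essential_extension_locally_artinian[OF S])
  qed
  moreover have "left_diamond TYPE('s) TYPE('e) (opposite_ring ?A)"
    unfolding left_diamond_def
  proof (intro allI impI, elim conjE)
    fix S :: "('k fps poly, 's) module" and E :: "('k fps poly, 'e) module" and \<iota>
    assume S: "simple_module (opposite_ring ?A) S"
      and "injective_hull (opposite_ring ?A) S E \<iota>"
    then have E: "left_module (opposite_ring ?A) E"
      and hom: "\<iota> \<in> lmodule_hom (opposite_ring ?A) S E" and inj: "inj_on \<iota> (carrier S)"
      and ess: "essential_submodule (opposite_ring ?A) E (\<iota> ` carrier S)"
      unfolding injective_hull_def injective_module_def by blast+
    have "locally_artinian ?B (restrict_scalars (twist_coeffs \<alpha>) E)"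
      by (rule i.essential_extension_locally_artinian[OF op.simple_restrict[OF S]
            op.left_module_restrict[OF E] op.lmodule_hom_restrict[OF hom]])
        (use inj op.essential_restrict[OF ess] in simp_all)
    then show "locally_artinian (opposite_ring ?A) E" by (rule op.locally_artinian_restrict[OF E])
  qed
  ultimately show ?thesis by (simp add: satisfies_diamond_def)
qed

end
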